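(* Let $N\ge 1$ be an integer, $\phi\in(-\pi/2,\pi/2)$ and $\lambda\in\mathbb{C}$. Consider the two equations $$-e^{-2i\phi}w''(x)-(ix)^{N+2}e^{(N+2)i\phi}w(x)=\lambda w(x),\quad x\in\mathbb{R}_+=[0,\infty),$$ $$-e^{2i\phi}w''(x)-(ix)^{N+2}e^{-(N+2)i\phi}w(x)=\lambda w(x),\quad x\in\mathbb{R}_-=(-\infty,0].$$ For each of these two equations exactly one of the following holds, independently of $\lambda$: (I) If $\phi\neq -\frac{N+2}{2N+8}\pi+\frac{2k}{N+4}\pi$ for all $k\in\mathbb{Z}$, then the equation has, up to a constant multiple, exactly one nonzero solution $w$ with $w\in L^2(\mathbb{R}_\pm)$ (respectively), and in particular it has a solution not in $L^2(\mathbb{R}_\pm)$ (limit-point case). (II) If $\phi=-\frac{N+2}{2N+8}\pi+\frac{2k}{N+4}\pi$ for some $k\in\mathbb{Z}$, then all solutions of the equation lie in $L^2(\mathbb{R}_\pm)$ (limit-circle case).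
   Context: These equations arise from $-y''(z)-(iz)^{N+2}y(z)=\lambda y(z)$ on the contour $\Gamma=\{xe^{i\phi\,\mathrm{sgn}(x)}:x\in\mathbb{R}\}$ via $w(x)=y(xe^{i\phi\,\mathrm{sgn}(x)})$. Solutions are understood as functions $w$ with $w,w'$ locally absolutely continuous on the respective half-line. *)

theory Defs
  imports "HOL-Analysis.Analysis"
begin

definition abs_cont_on_interval :: "(real \<Rightarrow> 'b::real_normed_vector) \<Rightarrow> real \<Rightarrow> real \<Rightarrow> bool" where
  "abs_cont_on_interval f a b \<longleftrightarrow>
     (\<forall>\<epsilon>>0. \<exists>\<delta>>0. \<forall>(n::nat) (u::nat \<Rightarrow> real) (v::nat \<Rightarrow> real).
        (\<forall>k<n. a \<le> u k \<and> u k \<le> v k \<and> v k \<le> b) \<and>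
        (\<forall>k<n. \<forall>j<n. k \<noteq> j \<longrightarrow> v k \<le> u j \<or> v j \<le> u k) \<and>
        (\<Sum>k<n. v k - u k) < \<delta>
        \<longrightarrow> (\<Sum>k<n. norm (f (v k) - f (u k))) < \<epsilon>)"

definition locally_abs_cont_on :: "real set \<Rightarrow> (real \<Rightarrow> 'b::real_normed_vector) \<Rightarrow> bool" where
  "locally_abs_cont_on S f \<longleftrightarrow> (\<forall>a b. a \<le> b \<and> {a..b} \<subseteq> S \<longrightarrow> abs_cont_on_interval f a b)"

text \<open>w is a solution on S of  - c w''(x) - q(x) w(x) = lam w(x):
  w and w' are locally absolutely continuous on S (w1 is the absolutely continuous
  representative of w') and the equation holds almost everywhere on S.\<close>
definition is_solution :: "real set \<Rightarrow> complex \<Rightarrow> (real \<Rightarrow> complex) \<Rightarrow> complex \<Rightarrow> (real \<Rightarrow> complex) \<Rightarrow> bool" where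
  "is_solution S c q lam w \<longleftrightarrow>
     (\<exists>w1 w2. locally_abs_cont_on S w \<and> locally_abs_cont_on S w1 \<and>
        (AE x in lborel. x \<in> S \<longrightarrow>
            (w has_vector_derivative w1 x) (at x) \<and>
            (w1 has_vector_derivative w2 x) (at x) \<and>
            - c * w2 x - q x * w x = lam * w x))"

definition L2_on :: "real set \<Rightarrow> (real \<Rightarrow> complex) \<Rightarrow> bool" where
  "L2_on S w \<longleftrightarrow> set_borel_measurable lborel S w \<and> set_integrable lborel S (\<lambda>x. (norm (w x))\<^sup>2)"

end

theory Submission
  imports Defs
begin

text \<open>On the right half-line the equation is \<open>w'' = (\<alpha> x\<^sup>m + \<beta>) w\<close> with \<open>m = N + 2\<close> and \<open>|\<alpha>| = 1\<close>; reflection turns the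
  left half-line into the same problem with \<open>\<alpha>\<close> conjugated, and the exceptional angles are those with \<open>\<alpha> = -1\<close>.

  If \<open>\<alpha> \<noteq> -1\<close>, the number \<open>\<eta> = 1 + cnj \<alpha>\<close> satisfies \<open>Re \<eta> > 0\<close> and \<open>Re (\<eta> \<alpha>) > 0\<close>, so \<open>F = Re (\<eta> w' cnj w)\<close> is
  eventually nondecreasing along every solution. A solution on which \<open>F\<close> becomes positive is not square integrable,
  while one on which \<open>F\<close> stays nonpositive is; the latter exists by compactness of the unit sphere of initial data.
  If \<open>\<alpha> = -1\<close>, a modified energy shows \<open>|w|\<^sup>2 = O(x powr (- m / 2))\<close> for every solution, which is integrable
  as \<open>m \<ge> 3\<close>.\<close>

subsection \<open>Absolutely continuous functions\<close>

text \<open>A solution is only locally absolutely continuous and satisfies the equation almost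
  everywhere, while the energy arguments differentiate at every point. The bridge is that an
  absolutely continuous function with derivative 0 almost everywhere is constant; it identifies
  \<open>is_solution\<close> with classical solutions. Since the coefficient is a polynomial,
  solutions with any initial data are obtained as entire power series, and uniqueness and changes of
  basis become Wronskian algebra; no asymptotic expansion of solutions enters. Dividing by the
  leading coefficient gives \<alpha> = \<open>- \<kappa> / c\<close>. For \<alpha> = -1 the term
  \<alpha> x^m is real and negative and solutions oscillate with decaying amplitude; any other
  \<alpha> of modulus 1 can be rotated, together with 1, into the open right half-plane. The
  spectral parameter enters only through \<beta>, a term of lower order than x^m, so it does not
  influence the alternative. One solution outside L2 already gives uniqueness up to multiples,
  because two independent solutions in L2 would span all solutions.\<close>

lemma abs_cont_on_intervalE:
  assumes "abs_cont_on_interval f a b" "e > 0"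
  obtains \<delta> where "\<delta> > 0"
    "\<And>n u v. (\<forall>k<n. a \<le> u k \<and> u k \<le> v k \<and> v k \<le> b) \<and>
       (\<forall>k<n. \<forall>j<n. k \<noteq> j \<longrightarrow> v k \<le> u j \<or> v j \<le> u k) \<and> (\<Sum>k<(n::nat). v k - u k) < \<delta>
        \<Longrightarrow> (\<Sum>k<n. norm (f (v k) - f (u k))) < e"
proof -
  from assms(1)[unfolded abs_cont_on_interval_def, rule_format, OF assms(2)] show ?thesis
    by (elim exE conjE) (rule that, assumption, erule allE, erule allE, erule allE, erule mp)
qed

lemma abs_cont_on_interval_mono:
  assumes "abs_cont_on_interval f a b" "a \<le> c" "d \<le> b"
  shows "abs_cont_on_interval f c d"
  unfolding abs_cont_on_interval_def
proof (intro allI impI)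
  fix e :: real assume "e > 0"
  obtain \<delta> where "\<delta> > 0" and \<delta>:
    "\<And>n u v. (\<forall>k<n. a \<le> u k \<and> u k \<le> v k \<and> v k \<le> b) \<and>
       (\<forall>k<n. \<forall>j<n. k \<noteq> j \<longrightarrow> v k \<le> u j \<or> v j \<le> u k) \<and> (\<Sum>k<(n::nat). v k - u k) < \<delta>
        \<Longrightarrow> (\<Sum>k<n. norm (f (v k) - f (u k))) < e"
    using assms(1) \<open>e > 0\<close> by (rule abs_cont_on_intervalE) blast
  show "\<exists>\<delta>>0. \<forall>(n::nat) u v. (\<forall>k<n. c \<le> u k \<and> u k \<le> v k \<and> v k \<le> d) \<and>
       (\<forall>k<n. \<forall>j<n. k \<noteq> j \<longrightarrow> v k \<le> u j \<or> v j \<le> u k) \<and> (\<Sum>k<n. v k - u k) < \<delta>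
        \<longrightarrow> (\<Sum>k<n. norm (f (v k) - f (u k))) < e"
  proof (intro exI[of _ \<delta>] conjI allI impI \<delta> \<open>\<delta> > 0\<close>; elim conjE)
    fix n k :: nat and u v assume "\<forall>k<n. c \<le> u k \<and> u k \<le> v k \<and> v k \<le> d" "k < n"
    then show "a \<le> u k" "u k \<le> v k" "v k \<le> b" using assms(2,3) by force+
  qed (assumption | blast)+
qed

lemma abs_cont_on_interval_lipschitz:
  assumes "\<And>x y. a \<le> x \<Longrightarrow> x \<le> y \<Longrightarrow> y \<le> b \<Longrightarrow> norm (f y - f x) \<le> L * (y - x)"
  shows "abs_cont_on_interval f a b"
  unfolding abs_cont_on_interval_def
proof (intro allI impI)
  fix e :: real assume "e > 0"
  \<comment> \<open>\<open>L\<close> may be zero or negative; \<open>M\<close> is positive, so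
    \<open>e / M\<close> can serve as \<delta>.\<close>
  define M where "M = max L 1"
  have M: "M > 0" "L \<le> M" by (auto simp: M_def)
  show "\<exists>\<delta>>0. \<forall>(n::nat) u v. (\<forall>k<n. a \<le> u k \<and> u k \<le> v k \<and> v k \<le> b) \<and>
       (\<forall>k<n. \<forall>j<n. k \<noteq> j \<longrightarrow> v k \<le> u j \<or> v j \<le> u k) \<and> (\<Sum>k<n. v k - u k) < \<delta>
        \<longrightarrow> (\<Sum>k<n. norm (f (v k) - f (u k))) < e"
  proof (intro exI[of _ "e / M"] conjI allI impI; (elim conjE)?)
    show "e / M > 0" using \<open>e > 0\<close> M by simp
    fix n :: nat and u v
    assume uv: "\<forall>k<n. a \<le> u k \<and> u k \<le> v k \<and> v k \<le> b" and s: "(\<Sum>k<n. v k - u k) < e / M"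
    have "norm (f (v k) - f (u k)) \<le> M * (v k - u k)" if "k < n" for k
    proof -
      have "norm (f (v k) - f (u k)) \<le> L * (v k - u k)" using uv that by (intro assms) auto
      also have "\<dots> \<le> M * (v k - u k)" using uv that M by (intro mult_right_mono) auto
      finally show ?thesis .
    qed
    then have "(\<Sum>k<n. norm (f (v k) - f (u k))) \<le> (\<Sum>k<n. M * (v k - u k))"
      by (intro sum_mono) auto
    also have "\<dots> = M * (\<Sum>k<n. v k - u k)" by (simp add: sum_distrib_left)
    also have "\<dots> < e" using s M by (simp add: field_simps)
    finally show "(\<Sum>k<n. norm (f (v k) - f (u k))) < e" .
  qed
qed

lemma abs_cont_on_interval_diff:
  assumes "abs_cont_on_interval f a b" "abs_cont_on_interval g a b"
  shows "abs_cont_on_interval (\<lambda>x. f x - g x) a b"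
  unfolding abs_cont_on_interval_def
proof (intro allI impI)
  fix e :: real assume "e > 0"
  then have "e / 2 > 0" by simp
  obtain \<delta>1 where "\<delta>1 > 0" and 1:
    "\<And>n u v. (\<forall>k<n. a \<le> u k \<and> u k \<le> v k \<and> v k \<le> b) \<and>
       (\<forall>k<n. \<forall>j<n. k \<noteq> j \<longrightarrow> v k \<le> u j \<or> v j \<le> u k) \<and> (\<Sum>k<(n::nat). v k - u k) < \<delta>1
        \<Longrightarrow> (\<Sum>k<n. norm (f (v k) - f (u k))) < e / 2"
    using assms(1) \<open>e / 2 > 0\<close> by (rule abs_cont_on_intervalE) blast
  obtain \<delta>2 where "\<delta>2 > 0" and 2:
    "\<And>n u v. (\<forall>k<n. a \<le> u k \<and> u k \<le> v k \<and> v k \<le> b) \<and>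
       (\<forall>k<n. \<forall>j<n. k \<noteq> j \<longrightarrow> v k \<le> u j \<or> v j \<le> u k) \<and> (\<Sum>k<(n::nat). v k - u k) < \<delta>2
        \<Longrightarrow> (\<Sum>k<n. norm (g (v k) - g (u k))) < e / 2"
    using assms(2) \<open>e / 2 > 0\<close> by (rule abs_cont_on_intervalE) blast
  show "\<exists>\<delta>>0. \<forall>(n::nat) u v. (\<forall>k<n. a \<le> u k \<and> u k \<le> v k \<and> v k \<le> b) \<and>
       (\<forall>k<n. \<forall>j<n. k \<noteq> j \<longrightarrow> v k \<le> u j \<or> v j \<le> u k) \<and> (\<Sum>k<n. v k - u k) < \<delta>
        \<longrightarrow> (\<Sum>k<n. norm (f (v k) - g (v k) - (f (u k) - g (u k)))) < e"
  proof (intro exI[of _ "min \<delta>1 \<delta>2"] conjI allI impI)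
    show "min \<delta>1 \<delta>2 > 0" using \<open>\<delta>1 > 0\<close> \<open>\<delta>2 > 0\<close> by simp
    fix n :: nat and u v
    assume *: "(\<forall>k<n. a \<le> u k \<and> u k \<le> v k \<and> v k \<le> b) \<and>
       (\<forall>k<n. \<forall>j<n. k \<noteq> j \<longrightarrow> v k \<le> u j \<or> v j \<le> u k) \<and> (\<Sum>k<n. v k - u k) < min \<delta>1 \<delta>2"
    have "(\<Sum>k<n. norm (f (v k) - g (v k) - (f (u k) - g (u k))))
        \<le> (\<Sum>k<n. norm (f (v k) - f (u k)) + norm (g (v k) - g (u k)))"
    proof (rule sum_mono)
      fix k
      have "f (v k) - g (v k) - (f (u k) - g (u k)) = (f (v k) - f (u k)) - (g (v k) - g (u k))" by simp
      then show "norm (f (v k) - g (v k) - (f (u k) - g (u k))) \<le> norm (f (v k) - f (u k)) + norm (g (v k) - g (u k))"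
        by (metis norm_triangle_ineq4)
    qed
    also have "\<dots> < e" using 1[of n u v] 2[of n u v] * by (simp add: sum.distrib)
    finally show "(\<Sum>k<n. norm (f (v k) - g (v k) - (f (u k) - g (u k)))) < e" .
  qed
qed

lemma abs_cont_on_interval_imp_continuous_on:
  fixes f :: "real \<Rightarrow> 'b::real_normed_vector"
  assumes "abs_cont_on_interval f a b"
  shows "continuous_on {a..b} f"
  unfolding continuous_on_iff
proof (intro ballI allI impI)
  fix x e :: real assume x: "x \<in> {a..b}" and "e > 0"
  obtain \<delta> where "\<delta> > 0" and \<delta>:
    "\<And>n u v. (\<forall>k<n. a \<le> u k \<and> u k \<le> v k \<and> v k \<le> b) \<and>
       (\<forall>k<n. \<forall>j<n. k \<noteq> j \<longrightarrow> v k \<le> u j \<or> v j \<le> u k) \<and> (\<Sum>k<(n::nat). v k - u k) < \<delta>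
        \<Longrightarrow> (\<Sum>k<n. norm (f (v k) - f (u k))) < e"
    using assms \<open>e > 0\<close> by (rule abs_cont_on_intervalE) blast
  have "dist (f y) (f x) < e" if "y \<in> {a..b}" "dist y x < \<delta>" for y
    using \<delta>[of 1 "\<lambda>_. min x y" "\<lambda>_. max x y"] x that
    by (cases "x \<le> y") (auto simp: dist_norm norm_minus_commute)
  with \<open>\<delta> > 0\<close> show "\<exists>d>0. \<forall>y\<in>{a..b}. dist y x < d \<longrightarrow> dist (f y) (f x) < e" by blast
qed

text \<open>Sum over a fine tagged division: tags outside \<open>E\<close> contribute little since the derivative vanishes there, tags in \<open>E\<close>
  since, \<open>E\<close> being negligible, their intervals have small total length. Degenerate intervals are left out of the latter
  sum because one may lie inside another interval of the division.\<close>

lemma abs_cont_derivative_zero_AE_imp_eq: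
  fixes f :: "real \<Rightarrow> 'b::real_normed_vector"
  assumes "a \<le> b" and ac: "abs_cont_on_interval f a b" and neg: "negligible E"
    and deriv: "\<And>x. x \<in> {a..b} - E \<Longrightarrow> (f has_vector_derivative 0) (at x within {a..b})"
  shows "f b = f a"
proof -
  have bound: "norm (f b - f a) \<le> e * (b - a) + e" if "e > 0" for e
  proof -
    obtain \<delta> where "\<delta> > 0" and \<delta>:
      "\<And>n u v. (\<forall>k<n. a \<le> u k \<and> u k \<le> v k \<and> v k \<le> b) \<and>
         (\<forall>k<n. \<forall>j<n. k \<noteq> j \<longrightarrow> v k \<le> u j \<or> v j \<le> u k) \<and> (\<Sum>k<(n::nat). v k - u k) < \<delta>
          \<Longrightarrow> (\<Sum>k<n. norm (f (v k) - f (u k))) < e"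
      using ac \<open>e > 0\<close> by (rule abs_cont_on_intervalE) blast
    have "((indicator E :: real \<Rightarrow> real) has_integral 0) {a..b}"
      using neg by (metis negligible_def box_real(2))
    then obtain \<gamma> where "gauge \<gamma>" and \<gamma>: "\<And>p. p tagged_division_of {a..b} \<Longrightarrow> \<gamma> fine p \<Longrightarrow>
        \<bar>\<Sum>(x,K)\<in>p. measure lborel K * indicator E x\<bar> < \<delta>"
      using \<open>\<delta> > 0\<close> unfolding has_integral_real by (auto simp: real_norm_def)
    have "\<exists>d>0. x \<in> {a..b} - E \<longrightarrow> (\<forall>y\<in>{a..b}. \<bar>y - x\<bar> < d \<longrightarrow> norm (f y - f x) \<le> e * \<bar>y - x\<bar>)" for x
    proof (cases "x \<in> {a..b} - E")
      case True
      from deriv[OF this] show ?thesis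
        using \<open>e > 0\<close> unfolding has_vector_derivative_def has_derivative_within_alt by auto
    qed (auto intro: exI[of _ 1])
    then obtain r where r: "\<And>x. r x > 0" and
      rd: "\<And>x y. x \<in> {a..b} \<Longrightarrow> x \<notin> E \<Longrightarrow> y \<in> {a..b} \<Longrightarrow> \<bar>y - x\<bar> < r x \<Longrightarrow> norm (f y - f x) \<le> e * \<bar>y - x\<bar>"
      by (metis Diff_iff)
    have "gauge (\<lambda>x. \<gamma> x \<inter> ball x (r x))"
      using \<open>gauge \<gamma>\<close> r by (intro gauge_Int gauge_ball_dependent) auto
    then obtain p where p: "p tagged_division_of {a..b}" and "(\<lambda>x. \<gamma> x \<inter> ball x (r x)) fine p"
      by (rule fine_division_exists_real)
    then have fine: "\<gamma> fine p" "(\<lambda>x. ball x (r x)) fine p" by (auto simp: fine_Int)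
    have fp: "finite p" using p by (rule tagged_division_of_finite)
    have K: "\<exists>u v. K = {u..v} \<and> u \<le> x \<and> x \<le> v \<and> a \<le> u \<and> v \<le> b" if "(x,K) \<in> p" for x K
      using tagged_division_ofD(2-4)[OF p that] by (fastforce simp: box_real)
    define ad where "ad = (\<lambda>K. norm (f (Sup K) - f (Inf K)))"
    define P where "P = {z \<in> p. fst z \<in> E \<and> Inf (snd z) < Sup (snd z)}"
    have P: "finite P" "P \<subseteq> p" using fp by (auto simp: P_def)
    obtain h where h: "bij_betw h {..<card P} P"
      using ex_bij_betw_nat_finite[OF P(1)] by (auto simp: atLeast0LessThan)
    have hP: "h k \<in> P" if "k < card P" for k using h that by (auto simp: bij_betw_def)
    have bad: "(\<Sum>z\<in>P. ad (snd z)) < e"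
    proof -
      have "(\<Sum>k<card P. norm (f (Sup (snd (h k))) - f (Inf (snd (h k))))) < e"
      proof (intro \<delta> conjI allI impI)
        fix k assume k: "k < card P"
        then obtain x K' where hk: "h k = (x, K')" "(x, K') \<in> p" using hP[OF k] P by (cases "h k") auto
        from K[OF hk(2)] hk show "a \<le> Inf (snd (h k))" "Inf (snd (h k)) \<le> Sup (snd (h k))" "Sup (snd (h k)) \<le> b"
          by auto
        fix j assume j: "j < card P" and "k \<noteq> j"
        then have ne: "h k \<noteq> h j" using h k by (auto simp: bij_betw_def inj_on_def)
        obtain y L where hj: "h j = (y, L)" "(y, L) \<in> p" using hP[OF j] P by (cases "h j") auto
        have int: "interior K' \<inter> interior L = {}"
          using tagged_division_ofD(5)[OF p hk(2) hj(2)] ne hk hj by auto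
        obtain u v u' v' where uv: "K' = {u..v}" "u \<le> v" "L = {u'..v'}" "u' \<le> v'"
          using K[OF hk(2)] K[OF hj(2)] by fastforce
        have "u < v" "u' < v'" using hP[OF k] hP[OF j] hk hj uv by (auto simp: P_def)
        have "v \<le> u' \<or> v' \<le> u"
        proof (rule ccontr)
          assume "\<not> ?thesis"
          \<comment> \<open>The midpoint of the overlap would be an interior point of both
            intervals.\<close>
          then have "(max u u' + min v v') / 2 \<in> {u<..<v} \<inter> {u'<..<v'}"
            using \<open>u < v\<close> \<open>u' < v'\<close> by (auto simp: max_def min_def)
          then show False using int uv by (auto simp: interior_atLeastAtMost_real)
        qed
        then show "Sup (snd (h k)) \<le> Inf (snd (h j)) \<or> Sup (snd (h j)) \<le> Inf (snd (h k))"
          using uv hk hj by auto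
      next
        have "(\<Sum>k<card P. Sup (snd (h k)) - Inf (snd (h k))) = (\<Sum>z\<in>P. Sup (snd z) - Inf (snd z))"
          using h by (rule sum.reindex_bij_betw)
        also have "\<dots> = (\<Sum>z\<in>P. measure lborel (snd z) * indicator E (fst z))"
        proof (rule sum.cong[OF refl])
          fix z assume "z \<in> P"
          with K[of "fst z" "snd z"] P show "Sup (snd z) - Inf (snd z) = measure lborel (snd z) * indicator E (fst z)"
            by (auto simp: P_def)
        qed
        also have "\<dots> \<le> (\<Sum>z\<in>p. measure lborel (snd z) * indicator E (fst z))"
          using fp P by (intro sum_mono2) auto
        also have "\<dots> = (\<Sum>(x,K)\<in>p. measure lborel K * indicator E x)" by (simp add: case_prod_beta)
        also have "\<dots> < \<delta>" using \<gamma>[OF p fine(1)] by linarith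
        finally show "(\<Sum>k<card P. Sup (snd (h k)) - Inf (snd (h k))) < \<delta>" .
      qed
      then show ?thesis
        using sum.reindex_bij_betw[OF h, of "\<lambda>z. ad (snd z)"] by (simp add: ad_def)
    qed
    have "f b - f a = (\<Sum>(x,K)\<in>p. f (Sup K) - f (Inf K))"
      using additive_tagged_division_1[OF \<open>a \<le> b\<close> p, of f] by simp
    then have "norm (f b - f a) \<le> (\<Sum>z\<in>p. ad (snd z))"
      by (simp add: ad_def case_prod_beta norm_sum)
    also have "\<dots> = (\<Sum>z\<in>p - P. ad (snd z)) + (\<Sum>z\<in>P. ad (snd z))"
      using fp P by (simp add: sum.subset_diff)
    also have "(\<Sum>z\<in>p - P. ad (snd z)) \<le> (\<Sum>z\<in>p. e * (Sup (snd z) - Inf (snd z)))"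
    proof (rule order_trans[OF sum_mono[of _ _ "\<lambda>z. e * (Sup (snd z) - Inf (snd z))"] sum_mono2])
      show "finite p" "p - P \<subseteq> p" using fp by auto
      show "0 \<le> e * (Sup (snd z) - Inf (snd z))" if "z \<in> p - (p - P)" for z
        using \<open>e > 0\<close> that by (auto simp: P_def)
      fix z assume z: "z \<in> p - P"
      obtain x L where zx: "z = (x,L)" by (cases z)
      obtain u v where uv: "L = {u..v}" "u \<le> x" "x \<le> v" "a \<le> u" "v \<le> b" using K[of x L] z zx by auto
      show "ad (snd z) \<le> e * (Sup (snd z) - Inf (snd z))"
      proof (cases "x \<in> E")
        case True
        then have "u = v" using z zx uv by (auto simp: P_def)
        then show ?thesis using uv zx by (simp add: ad_def)
      next
        case False
        have sub: "{u..v} \<subseteq> ball x (r x)" using fine(2) z zx uv by (auto simp: fine_def)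
        have uin: "u \<in> ball x (r x)" and vin: "v \<in> ball x (r x)" using uv subsetD[OF sub, of u] subsetD[OF sub, of v] by auto
        \<comment> \<open>The tag splits \<open>{u..v}\<close>: the derivative estimate applies from
          \<open>x\<close> to either end, and the two distances add up to
          \<open>v - u\<close>.\<close>
        have "norm (f v - f u) \<le> norm (f v - f x) + norm (f u - f x)"
          by (metis norm_diff_triangle_le norm_minus_commute order_refl)
        also have "\<dots> \<le> e * \<bar>v - x\<bar> + e * \<bar>u - x\<bar>"
          using uv uin vin False by (intro add_mono rd) (auto simp: dist_real_def)
        also have "\<dots> = e * (v - u)" using uv by (simp add: algebra_simps)
        finally show ?thesis using uv zx by (simp add: ad_def)
      qed
    qed
    also have "(\<Sum>z\<in>p. e * (Sup (snd z) - Inf (snd z))) = e * (b - a)"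
      using additive_tagged_division_1[OF \<open>a \<le> b\<close> p, of "\<lambda>x. x"]
      by (simp add: case_prod_beta flip: sum_distrib_left)
    finally show ?thesis using bad by linarith
  qed
  have *: "norm (f b - f a) \<le> e * (b - a + 1)" if "e > 0" for e
    using bound[OF that] by (simp add: algebra_simps)
  have "norm (f b - f a) \<le> 0"
  proof (rule field_le_epsilon)
    fix e :: real assume "e > 0"
    then show "norm (f b - f a) \<le> 0 + e"
      using *[of "e / (b - a + 1)"] \<open>a \<le> b\<close> by simp
  qed
  then show ?thesis by simp
qed

text \<open>Comparison with the primitive \<open>G\<close> of \<open>g\<close>, which is Lipschitz
  and hence absolutely continuous: \<open>f - G\<close> has derivative 0 off \<open>E\<close>, so it
  is constant, and \<open>f\<close> inherits the derivative of \<open>G\<close> at every point,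
  those of \<open>E\<close> included.\<close>

lemma abs_cont_AE_derivative_continuous:
  fixes f g :: "real \<Rightarrow> 'b::banach"
  assumes ac: "abs_cont_on_interval f a b" and cont: "continuous_on {a..b} g" and neg: "negligible E"
    and deriv: "\<And>x. x \<in> {a..b} - E \<Longrightarrow> (f has_vector_derivative g x) (at x within {a..b})"
    and x: "x \<in> {a..b}"
  shows "(f has_vector_derivative g x) (at x within {a..b})"
proof -
  define G where "G = (\<lambda>x. integral {a..x} g)"
  have G: "(G has_vector_derivative g x) (at x within {a..b})" if "x \<in> {a..b}" for x
    unfolding G_def using cont that by (rule integral_has_vector_derivative)
  obtain L where L: "\<And>x. x \<in> {a..b} \<Longrightarrow> norm (g x) \<le> L"
    using compact_continuous_image[OF cont] by (metis compact_Icc bounded_iff compact_imp_bounded imageI)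
  have "abs_cont_on_interval G a b"
  proof (rule abs_cont_on_interval_lipschitz)
    fix x y assume "a \<le> x" "x \<le> y" "y \<le> b"
    then have "G y - G x = integral {x..y} g"
      unfolding G_def using cont
      by (subst Henstock_Kurzweil_Integration.integral_combine[of a x y, symmetric])
         (auto intro!: integrable_continuous_real elim: continuous_on_subset)
    also have "norm \<dots> \<le> L * (y - x)"
      using \<open>a \<le> x\<close> \<open>x \<le> y\<close> \<open>y \<le> b\<close> L cont by (intro integral_bound) (auto elim: continuous_on_subset)
    finally show "norm (G y - G x) \<le> L * (y - x)" .
  qed
  then have ac': "abs_cont_on_interval (\<lambda>x. f x - G x) a b" by (intro abs_cont_on_interval_diff ac)
  have eq: "f y = (f a - G a) + G y" if y: "y \<in> {a..b}" for y
  proof -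
    have "f y - G y = f a - G a"
    proof (rule abs_cont_derivative_zero_AE_imp_eq[OF _ _ neg])
      show "a \<le> y" using y by simp
      show "abs_cont_on_interval (\<lambda>x. f x - G x) a y"
        using ac' by (rule abs_cont_on_interval_mono) (use y in auto)
      fix z assume z: "z \<in> {a..y} - E"
      have "((\<lambda>x. f x - G x) has_vector_derivative g z - g z) (at z within {a..b})"
        using z y by (intro has_vector_derivative_diff deriv G) auto
      then show "((\<lambda>x. f x - G x) has_vector_derivative 0) (at z within {a..y})"
        using y by (auto intro: has_vector_derivative_within_subset)
    qed
    then show ?thesis by (simp add: algebra_simps)
  qed
  have "((\<lambda>y. (f a - G a) + G y) has_vector_derivative 0 + g x) (at x within {a..b})"
    using x by (intro has_vector_derivative_add has_vector_derivative_const G)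
  then show ?thesis
    using has_vector_derivative_transform[OF x, of f "\<lambda>y. (f a - G a) + G y", OF eq] by simp
qed

subsection \<open>Classical solutions and square integrability\<close>

text \<open>The derivative is carried along as a second function, which turns w'' = Q w into a
  first-order system. Derivatives are taken within \<open>S\<close>, so the end point of a half-line
  is covered by a one-sided derivative.\<close>

definition classical_sol :: "real set \<Rightarrow> (real \<Rightarrow> complex) \<Rightarrow> (real \<Rightarrow> complex) \<Rightarrow> (real \<Rightarrow> complex) \<Rightarrow> bool" where
  "classical_sol S Q w w' \<longleftrightarrow> (\<forall>x\<in>S. (w has_vector_derivative w' x) (at x within S) \<and>
     (w' has_vector_derivative Q x * w x) (at x within S))"

lemma classical_solD:
  assumes "classical_sol S Q w w'" "x \<in> S"
  shows "(w has_vector_derivative w' x) (at x within S)"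
    and "(w' has_vector_derivative Q x * w x) (at x within S)"
  using assms by (auto simp: classical_sol_def)

lemma classical_sol_continuous_on:
  assumes "classical_sol S Q w w'"
  shows "continuous_on S w" "continuous_on S w'"
  using classical_solD[OF assms] by (auto intro!: continuous_on_vector_derivative)

lemma abs_cont_on_interval_C1:
  fixes f g :: "real \<Rightarrow> 'b::banach"
  assumes "\<And>x. x \<in> {a..b} \<Longrightarrow> (f has_vector_derivative g x) (at x within {a..b})"
    and cont: "continuous_on {a..b} g"
  shows "abs_cont_on_interval f a b"
proof -
  obtain L where L: "\<And>x. x \<in> {a..b} \<Longrightarrow> norm (g x) \<le> L"
    using compact_continuous_image[OF cont] by (metis compact_Icc bounded_iff compact_imp_bounded imageI)
  show ?thesis
  proof (rule abs_cont_on_interval_lipschitz)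
    fix x y assume xy: "a \<le> x" "x \<le> y" "y \<le> b"
    have "(g has_integral f y - f x) {x..y}"
      using xy by (intro fundamental_theorem_of_calculus)
        (auto intro!: has_vector_derivative_within_subset[OF assms(1)])
    then have "f y - f x = integral {x..y} g" by (simp add: integral_unique)
    also have "norm \<dots> \<le> L * (y - x)"
      using xy L cont by (intro integral_bound) (auto elim: continuous_on_subset)
    finally show "norm (f y - f x) \<le> L * (y - x)" .
  qed
qed

text \<open>Regularity is gained twice: \<open>w1\<close> is continuous, so it is the derivative of
  \<open>w\<close> everywhere; then the equation gives \<open>w1\<close> a derivative that agrees
  almost everywhere with a continuous function, so this too holds everywhere. Conversely, C1
  functions are Lipschitz on compact intervals.\<close>

lemma is_solution_iff_classical:
  assumes "is_interval S" "closed S" "c \<noteq> 0" and q: "continuous_on S q"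
  shows "is_solution S c q lam w \<longleftrightarrow> (\<exists>w'. classical_sol S (\<lambda>x. - (q x + lam) / c) w w')"
proof
  assume "is_solution S c q lam w"
  then obtain w1 w2 where ac: "locally_abs_cont_on S w" "locally_abs_cont_on S w1" and
    ae: "AE x in lborel. x \<in> S \<longrightarrow> (w has_vector_derivative w1 x) (at x) \<and>
            (w1 has_vector_derivative w2 x) (at x) \<and> - c * w2 x - q x * w x = lam * w x"
    unfolding is_solution_def by blast
  from ae obtain E where E: "E \<in> null_sets lborel" "\<And>x. x \<notin> E \<Longrightarrow> x \<in> S \<Longrightarrow> (w has_vector_derivative w1 x) (at x) \<and>
            (w1 has_vector_derivative w2 x) (at x) \<and> - c * w2 x - q x * w x = lam * w x"
    unfolding eventually_ae_filter by auto
  have neg: "negligible E"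
    using E(1) by (simp add: negligible_iff_null_sets null_sets_completionI)
  have "classical_sol S (\<lambda>x. - (q x + lam) / c) w w1"
    unfolding classical_sol_def
  proof
    fix x assume x: "x \<in> S"
    \<comment> \<open>Absolute continuity is available on compact intervals only. Cutting
      \<open>S\<close> at distance 1 from \<open>x\<close> gives one on which derivatives at
      \<open>x\<close> mean the same as within \<open>S\<close>.\<close>
    have "is_interval (S \<inter> {x-1..x+1})" "compact (S \<inter> {x-1..x+1})"
      using assms(1,2) by (auto intro: is_interval_Int is_interval_cc closed_Int_compact)
    then obtain a b where ab: "S \<inter> {x-1..x+1} = {a..b}"
      by (metis is_interval_compact box_real(2))
    then have sub: "{a..b} \<subseteq> S" and xab: "x \<in> {a..b}" using x by auto
    then have ac': "abs_cont_on_interval w a b" "abs_cont_on_interval w1 a b"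
      using ac by (auto simp: locally_abs_cont_on_def)
    then have cont: "continuous_on {a..b} w" "continuous_on {a..b} w1"
      by (auto intro: abs_cont_on_interval_imp_continuous_on)
    have at: "at x within {a..b} = at x within S"
      unfolding ab[symmetric] by (rule at_within_nhd[of x "{x-1<..<x+1}"]) auto
    have "(w has_vector_derivative w1 x) (at x within {a..b})"
      using ac'(1) cont(2) neg _ xab
      by (rule abs_cont_AE_derivative_continuous)
         (meson DiffD1 DiffD2 E(2) has_vector_derivative_at_within subsetD sub)
    moreover have "(w1 has_vector_derivative - (q x + lam) / c * w x) (at x within {a..b})"
      using ac'(2) _ neg _ xab
    proof (rule abs_cont_AE_derivative_continuous)
      show "continuous_on {a..b} (\<lambda>x. - (q x + lam) / c * w x)"
        using \<open>c \<noteq> 0\<close> by (intro continuous_intros ballI cont continuous_on_subset[OF q sub])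
      fix y assume y: "y \<in> {a..b} - E"
      with E(2)[of y] sub have d: "(w1 has_vector_derivative w2 y) (at y)"
        and eq: "- c * w2 y - q y * w y = lam * w y" by auto
      have "w2 y = - (q y + lam) / c * w y"
      proof -
        have "c * w2 y = - (q y + lam) * w y"
          using eq by (metis add_diff_cancel_left' add_uminus_conv_diff distrib_right minus_diff_eq minus_mult_left diff_add_cancel)
        then show ?thesis using \<open>c \<noteq> 0\<close> by (simp add: field_simps)
      qed
      with d show "(w1 has_vector_derivative - (q y + lam) / c * w y) (at y within {a..b})"
        by (auto intro: has_vector_derivative_at_within)
    qed
    ultimately show "(w has_vector_derivative w1 x) (at x within S) \<and>
        (w1 has_vector_derivative - (q x + lam) / c * w x) (at x within S)"
      by (simp add: at)
  qed
  then show "\<exists>w'. classical_sol S (\<lambda>x. - (q x + lam) / c) w w'" by blast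
next
  assume "\<exists>w'. classical_sol S (\<lambda>x. - (q x + lam) / c) w w'"
  then obtain w' where w': "classical_sol S (\<lambda>x. - (q x + lam) / c) w w'" by blast
  note D = classical_solD[OF w'] and C = classical_sol_continuous_on[OF w']
  have "locally_abs_cont_on S w"
    unfolding locally_abs_cont_on_def
  proof (intro allI impI; elim conjE)
    fix a b assume sub: "{a..b} \<subseteq> S"
    show "abs_cont_on_interval w a b"
      by (rule abs_cont_on_interval_C1[of a b w w'])
         (use sub in \<open>auto intro!: has_vector_derivative_within_subset[OF D(1)] continuous_on_subset[OF C(2)]\<close>)
  qed
  moreover have "locally_abs_cont_on S w'"
    unfolding locally_abs_cont_on_def
  proof (intro allI impI; elim conjE)
    fix a b assume sub: "{a..b} \<subseteq> S"
    show "abs_cont_on_interval w' a b"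
    proof (rule abs_cont_on_interval_C1[of a b w' "\<lambda>x. - (q x + lam) / c * w x"])
      show "continuous_on {a..b} (\<lambda>x. - (q x + lam) / c * w x)"
        using \<open>c \<noteq> 0\<close> by (intro continuous_intros ballI continuous_on_subset[OF q sub] continuous_on_subset[OF C(1) sub])
    qed (use sub in \<open>blast intro: has_vector_derivative_within_subset[OF D(2)]\<close>)
  qed
  moreover have "AE x in lborel. x \<in> S \<longrightarrow> (w has_vector_derivative w' x) (at x) \<and>
            (w' has_vector_derivative - (q x + lam) / c * w x) (at x) \<and> - c * (- (q x + lam) / c * w x) - q x * w x = lam * w x"
  proof -
    \<comment> \<open>\<open>is_solution\<close> asks for two-sided derivatives, which at a boundary
      point of \<open>S\<close> depend on values outside \<open>S\<close>; the frontier of an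
      interval is a null set.\<close>
    have "negligible (frontier S)"
      using assms(1) by (intro negligible_convex_frontier) (simp add: is_interval_convex)
    then have "frontier S \<in> null_sets lborel"
      by (simp add: negligible_iff_null_sets null_sets_completion_iff)
    then have "AE x in lborel. x \<notin> frontier S" by (rule AE_not_in)
    then show ?thesis
    proof eventually_elim
      case (elim x)
      show ?case
      proof
        assume x: "x \<in> S"
        with elim have "x \<in> interior S" using \<open>closed S\<close> by (auto simp: frontier_def)
        then have "at x within S = at x" by (rule at_within_interior)
        with D[OF x] \<open>c \<noteq> 0\<close> show "(w has_vector_derivative w' x) (at x) \<and>
            (w' has_vector_derivative - (q x + lam) / c * w x) (at x) \<and> - c * (- (q x + lam) / c * w x) - q x * w x = lam * w x"
          by (simp add: add_divide_distrib diff_divide_distrib algebra_simps)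
      qed
    qed
  qed
  ultimately show "is_solution S c q lam w"
    unfolding is_solution_def
    by (intro exI[of _ w'] exI[of _ "\<lambda>x. - (q x + lam) / c * w x"] conjI)
qed

section \<open>Reflection at 0 and linear combinations\<close>

lemma classical_sol_reflect:
  assumes "classical_sol S Q w w'"
  shows "classical_sol (uminus ` S) (\<lambda>x. Q (- x)) (\<lambda>x. w (- x)) (\<lambda>x. - w' (- x))"
  unfolding classical_sol_def
proof
  fix x assume "x \<in> uminus ` S"
  then have x: "- x \<in> S" by auto
  have m: "(uminus has_vector_derivative -1) (at x within uminus ` S)"
    by (auto intro!: derivative_eq_intros)
  have "((w \<circ> uminus) has_vector_derivative (-1) *\<^sub>R w' (- x)) (at x within uminus ` S)"
    by (rule vector_diff_chain_within[OF m]) (use classical_solD[OF assms x] in \<open>simp add: image_image\<close>)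
  moreover have "((w' \<circ> uminus) has_vector_derivative (-1) *\<^sub>R (Q (- x) * w (- x))) (at x within uminus ` S)"
    by (rule vector_diff_chain_within[OF m]) (use classical_solD[OF assms x] in \<open>simp add: image_image\<close>)
  then have "((\<lambda>x. - (w' \<circ> uminus) x) has_vector_derivative - ((-1) *\<^sub>R (Q (- x) * w (- x)))) (at x within uminus ` S)"
    by (rule has_vector_derivative_minus)
  ultimately show "((\<lambda>x. w (- x)) has_vector_derivative - w' (- x)) (at x within uminus ` S) \<and>
    ((\<lambda>x. - w' (- x)) has_vector_derivative Q (- x) * w (- x)) (at x within uminus ` S)"
    by (simp add: o_def)
qed

lemma L2_on_reflect:
  assumes "L2_on S w"
  shows "L2_on (uminus ` S) (\<lambda>x. w (- x))"
proof -
  have ind: "indicator (uminus ` S) x = (indicator S (- x) :: real)" for x :: real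
    by (auto simp: indicator_def image_iff) (metis minus_minus)
  have "(\<lambda>x. indicator S x *\<^sub>R w x) \<in> borel_measurable lborel"
    using assms by (simp add: L2_on_def set_borel_measurable_def)
  then have "(\<lambda>x. indicator S (- x) *\<^sub>R w (- x)) \<in> borel_measurable lborel"
    by (rule measurable_compose[of uminus lborel lborel, rotated]) simp
  moreover have "integrable lborel (\<lambda>x. indicator S x *\<^sub>R (norm (w x))\<^sup>2)"
    using assms by (simp add: L2_on_def set_integrable_def)
  then have "integrable lborel (\<lambda>x. indicator S (- x) *\<^sub>R (norm (w (- x)))\<^sup>2)"
    using lborel_integrable_real_affine_iff[of "-1" "\<lambda>x. indicator S x *\<^sub>R (norm (w x))\<^sup>2" 0] by simp
  ultimately show ?thesis
    by (simp add: L2_on_def set_borel_measurable_def set_integrable_def ind)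
qed

lemma L2_on_linear_combination:
  assumes u: "L2_on S u" and v: "L2_on S v"
  shows "L2_on S (\<lambda>x. a * u x + b * v x)"
proof -
  have m: "(\<lambda>x. indicator S x *\<^sub>R u x) \<in> borel_measurable lborel" "(\<lambda>x. indicator S x *\<^sub>R v x) \<in> borel_measurable lborel"
    using assms by (auto simp: L2_on_def set_borel_measurable_def)
  have eq: "(\<lambda>x. indicator S x *\<^sub>R (a * u x + b * v x)) = (\<lambda>x. a * (indicator S x *\<^sub>R u x) + b * (indicator S x *\<^sub>R v x))"
    by (auto simp: algebra_simps)
  have meas: "(\<lambda>x. indicator S x *\<^sub>R (a * u x + b * v x)) \<in> borel_measurable lborel"
    unfolding eq using m by measurable
  have "(\<lambda>x. indicator S x *\<^sub>R (norm (a * u x + b * v x))\<^sup>2) = (\<lambda>x. (norm (indicator S x *\<^sub>R (a * u x + b * v x)))\<^sup>2)"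
    by (auto simp: indicator_def)
  moreover have "\<dots> \<in> borel_measurable lborel" using meas by measurable
  ultimately have meas2: "set_borel_measurable lborel S (\<lambda>x. (norm (a * u x + b * v x))\<^sup>2)"
    by (simp add: set_borel_measurable_def)
  have int: "set_integrable lborel S (\<lambda>x. 2 * (norm a)\<^sup>2 * (norm (u x))\<^sup>2 + 2 * (norm b)\<^sup>2 * (norm (v x))\<^sup>2)"
    using assms by (intro set_integral_add set_integrable_mult_right) (auto simp: L2_on_def)
  have "(norm (a * u x + b * v x))\<^sup>2 \<le> 2 * (norm a)\<^sup>2 * (norm (u x))\<^sup>2 + 2 * (norm b)\<^sup>2 * (norm (v x))\<^sup>2" for x
  proof -
    have "(norm (a * u x + b * v x))\<^sup>2 \<le> (norm a * norm (u x) + norm b * norm (v x))\<^sup>2"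
      by (intro power_mono) (metis norm_mult norm_triangle_ineq, simp)
    also have "\<dots> \<le> 2 * (norm a * norm (u x))\<^sup>2 + 2 * (norm b * norm (v x))\<^sup>2"
      using sum_squares_bound[of "norm a * norm (u x)" "norm b * norm (v x)"] by (simp add: power2_sum)
    finally show ?thesis by (simp add: power_mult_distrib mult_ac)
  qed
  then have "set_integrable lborel S (\<lambda>x. (norm (a * u x + b * v x))\<^sup>2)"
    by (intro set_integrable_bound[OF int meas2]) (auto intro!: AE_I2 order_trans[OF _ abs_ge_self])
  then show ?thesis using meas by (simp add: L2_on_def set_borel_measurable_def)
qed

section \<open>Square integrability on the half-line through integrals over compact
  intervals\<close>

lemma L2_on_atLeast_imp_integral_bounded:
  assumes w: "continuous_on {0..} w" and "L2_on {0..} w"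
  obtains K where "\<And>X Y. 0 \<le> X \<Longrightarrow> integral {X..Y} (\<lambda>x. (norm (w x))\<^sup>2) \<le> K"
proof
  have int: "(\<lambda>x. (norm (w x))\<^sup>2) integrable_on {0..}"
    using assms(2) by (simp add: L2_on_def set_borel_integral_eq_integral)
  fix X Y :: real assume X: "0 \<le> X"
  show "integral {X..Y} (\<lambda>x. (norm (w x))\<^sup>2) \<le> integral {0..} (\<lambda>x. (norm (w x))\<^sup>2)"
    using X by (intro integral_subset_le int integrable_continuous_real continuous_intros continuous_on_subset[OF w]) auto
qed

text \<open>Monotone convergence along the intervals \<open>{0..real n}\<close>, whose integrals are
  bounded by the part up to \<open>X\<close> plus \<open>K\<close>.\<close>

lemma L2_on_atLeastI:
  assumes w: "continuous_on {0..} w" and X: "0 \<le> X"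
    and bound: "\<And>Y. X \<le> Y \<Longrightarrow> integral {X..Y} (\<lambda>x. (norm (w x))\<^sup>2) \<le> K"
  shows "L2_on {0..} w"
proof -
  define f where "f = (\<lambda>x. (norm (w x))\<^sup>2)"
  have f: "continuous_on {0..} f" unfolding f_def by (intro continuous_intros w)
  have f0: "f x \<ge> 0" for x by (simp add: f_def)
  have int: "f integrable_on {a..b}" if "0 \<le> a" for a b
    using that by (intro integrable_continuous_real continuous_on_subset[OF f]) auto
  have si: "set_integrable lborel {0..real n} f" for n
    by (intro borel_integrable_atLeastAtMost' continuous_on_subset[OF f]) auto
  define I where "I = (\<lambda>n::nat. integral {0..real n} f)"
  have I: "(LINT x|lborel. indicator {0..real n} x *\<^sub>R f x) = I n" for n
    using set_borel_integral_eq_integral(2)[OF si[of n]] by (simp add: I_def set_lebesgue_integral_def)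
  have inc: "incseq I"
    unfolding I_def incseq_def by (intro allI impI integral_subset_le int) (use f0 in auto)
  have bdd: "I n \<le> integral {0..X} f + K" for n
  proof -
    have "I n \<le> integral {0..max X (real n)} f"
      unfolding I_def by (intro integral_subset_le int) (use f0 in auto)
    also have "\<dots> = integral {0..X} f + integral {X..max X (real n)} f"
      using X int by (intro Henstock_Kurzweil_Integration.integral_combine[symmetric]) auto
    also have "\<dots> \<le> integral {0..X} f + K" using bound[of "max X (real n)"] by (simp add: f_def)
    finally show ?thesis .
  qed
  obtain l where l: "I \<longlonglongrightarrow> l" using incseq_convergent[OF inc] bdd by blast
  have "integrable lborel (\<lambda>x. indicator {0..} x *\<^sub>R f x)"
  proof (rule integrable_monotone_convergence)
    show "integrable lborel (\<lambda>x. indicator {0..real n} x *\<^sub>R f x)" for n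
      using si by (simp add: set_integrable_def)
    show "AE x in lborel. mono (\<lambda>n. indicator {0..real n} x *\<^sub>R f x)"
      using f0 by (auto intro!: AE_I2 monoI simp: indicator_def)
    show "AE x in lborel. (\<lambda>n. indicator {0..real n} x *\<^sub>R f x) \<longlonglongrightarrow> indicator {0..} x *\<^sub>R f x"
    proof (intro AE_I2 tendsto_eventually)
      fix x :: real
      have "\<forall>\<^sub>F n in sequentially. real n \<ge> x"
        using filterlim_real_sequentially by (simp add: filterlim_at_top)
      then show "\<forall>\<^sub>F n in sequentially. indicator {0..real n} x *\<^sub>R f x = indicator {0..} x *\<^sub>R f x"
        by eventually_elim (auto simp: indicator_def)
    qed
    show "(\<lambda>n. LINT x|lborel. indicator {0..real n} x *\<^sub>R f x) \<longlonglongrightarrow> l" using l by (simp only: I)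
    show "(\<lambda>x. indicator {0..} x *\<^sub>R f x) \<in> borel_measurable lborel"
      using borel_measurable_continuous_on_indicator[OF _ f] by simp
  qed
  moreover have "set_borel_measurable lborel {0..} w"
    unfolding set_borel_measurable_def using borel_measurable_continuous_on_indicator[OF _ w] by simp
  ultimately show ?thesis by (simp add: L2_on_def set_integrable_def f_def)
qed

text \<open>The integral of |w|^2 over \<open>{X..Y}\<close> is at most \<open>G Y - G X\<close>,
  hence at most \<open>B - G X\<close>. Both square-integrability proofs end here: with the rotated
  energy as \<open>G\<close> in the limit-point case, with a multiple of a negative power of
  \<open>x\<close> in the limit-circle case.\<close>

lemma L2_on_atLeast_if_derivative_dominates:
  assumes w: "continuous_on {0..} w" and X: "0 \<le> X"
    and G: "\<And>x. X \<le> x \<Longrightarrow> (G has_real_derivative g x) (at x)"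
    and g: "\<And>x. X \<le> x \<Longrightarrow> (norm (w x))\<^sup>2 \<le> g x" and B: "\<And>x. X \<le> x \<Longrightarrow> G x \<le> B"
  shows "L2_on {0..} w"
proof (rule L2_on_atLeastI[OF w X])
  fix Y assume Y: "X \<le> Y"
  have 1: "(g has_integral G Y - G X) {X..Y}"
    using G Y by (intro fundamental_theorem_of_calculus)
      (auto simp flip: has_real_derivative_iff_has_vector_derivative intro: has_field_derivative_at_within)
  have 2: "(\<lambda>x. (norm (w x))\<^sup>2) integrable_on {X..Y}"
    using X by (intro integrable_continuous_real continuous_intros continuous_on_subset[OF w]) auto
  have "integral {X..Y} (\<lambda>x. (norm (w x))\<^sup>2) \<le> G Y - G X"
    using has_integral_le[OF integrable_integral[OF 2] 1] g by auto
  then show "integral {X..Y} (\<lambda>x. (norm (w x))\<^sup>2) \<le> B - G X" using B[OF Y] by linarith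
qed

subsection \<open>Fundamental systems\<close>

lemma classical_sol_linear_combination:
  assumes "classical_sol S Q u u'" "classical_sol S Q v v'"
  shows "classical_sol S Q (\<lambda>x. a * u x + b * v x) (\<lambda>x. a * u' x + b * v' x)"
  unfolding classical_sol_def
proof (intro ballI conjI)
  fix x assume x: "x \<in> S"
  note d = classical_solD[OF assms(1) x] classical_solD[OF assms(2) x]
  show "((\<lambda>x. a * u x + b * v x) has_vector_derivative a * u' x + b * v' x) (at x within S)"
    by (intro has_vector_derivative_add has_vector_derivative_mult_right d)
  have "((\<lambda>x. a * u' x + b * v' x) has_vector_derivative a * (Q x * u x) + b * (Q x * v x)) (at x within S)"
    by (intro has_vector_derivative_add has_vector_derivative_mult_right d)
  then show "((\<lambda>x. a * u' x + b * v' x) has_vector_derivative Q x * (a * u x + b * v x)) (at x within S)"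
    by (simp add: algebra_simps)
qed

text \<open>The equation has no first-order term, so the two contributions
  \<open>Q x * u x * v x\<close> to the derivative cancel.\<close>

lemma wronskian_constant:
  assumes "convex S" "classical_sol S Q u u'" "classical_sol S Q v v'"
  obtains C where "\<And>x. x \<in> S \<Longrightarrow> u x * v' x - u' x * v x = C"
proof (rule has_vector_derivative_zero_constant[OF assms(1)])
  fix x assume x: "x \<in> S"
  note d = classical_solD[OF assms(2) x] classical_solD[OF assms(3) x]
  have "((\<lambda>x. u x * v' x - u' x * v x) has_vector_derivative
      (u x * (Q x * v x) + u' x * v' x) - (u' x * v' x + Q x * u x * v x)) (at x within S)"
    by (intro has_vector_derivative_diff has_vector_derivative_mult d)
  then show "((\<lambda>x. u x * v' x - u' x * v x) has_vector_derivative 0) (at x within S)"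
    by (simp add: algebra_simps)
qed blast

text \<open>Cramer's rule at each point. The coefficients are quotients of Wronskians, and since
  these are constant the same \<open>a\<close> and \<open>b\<close> serve all points.\<close>

lemma classical_sol_eq_combination:
  assumes S: "convex S" and u: "classical_sol S Q u u'" and v: "classical_sol S Q v v'" and w: "classical_sol S Q w w'"
    and W: "\<And>x. x \<in> S \<Longrightarrow> u x * v' x - u' x * v x = C" and C: "C \<noteq> 0"
  obtains a b where "\<And>x. x \<in> S \<Longrightarrow> w x = a * u x + b * v x"
    "\<And>x. x \<in> S \<Longrightarrow> w' x = a * u' x + b * v' x"
proof -
  obtain A where A: "\<And>x. x \<in> S \<Longrightarrow> w x * v' x - w' x * v x = A" using wronskian_constant[OF S w v] by blast
  obtain B where B: "\<And>x. x \<in> S \<Longrightarrow> u x * w' x - u' x * w x = B" using wronskian_constant[OF S u w] by blast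
  have "C * w x = A * u x + B * v x" "C * w' x = A * u' x + B * v' x" if "x \<in> S" for x
    unfolding A[OF that, symmetric] B[OF that, symmetric] W[OF that, symmetric] by algebra+
  then show ?thesis using C by (intro that[of "A / C" "B / C"]) (auto simp: field_simps)
qed

text \<open>Power series coefficients of the solution of W'' = P W with W(0) = \<open>a\<close> and
  W'(0) = \<open>b\<close>; the recursion compares coefficients of z^n on both sides.\<close>

fun sol_coeff :: "complex poly \<Rightarrow> complex \<Rightarrow> complex \<Rightarrow> nat \<Rightarrow> complex" where
  "sol_coeff P a b 0 = a"
| "sol_coeff P a b (Suc 0) = b"
| "sol_coeff P a b (Suc (Suc n)) =
     (\<Sum>i\<le>n. coeff P i * sol_coeff P a b (n - i)) / (of_nat (Suc n) * of_nat (Suc (Suc n)))"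

text \<open>For the weighted terms \<open>norm (sol_coeff P a b n) * r ^ n\<close> the recursion
  multiplies a bound on all earlier terms by at most A r^2 / ((k+1)(k+2)), where n = k + 2. This
  factor is at most 1 from \<open>n0\<close> on, so the finitely many terms up to
  \<open>Suc n0\<close> already bound the rest. As \<open>r\<close> is arbitrary, the series
  converges everywhere.\<close>

lemma sol_coeff_bounded:
  fixes r :: real
  assumes r: "r > 0"
  obtains M where "\<And>n. norm (sol_coeff P a b n) * r ^ n \<le> M"
proof -
  let ?c = "sol_coeff P a b"
  define A where "A = (\<Sum>i\<le>degree P. norm (coeff P i) * r ^ i)"
  have A: "(\<Sum>i\<le>n. norm (coeff P i) * r ^ i) \<le> A" for n
  proof -
    have "(\<Sum>i\<le>n. norm (coeff P i) * r ^ i) = (\<Sum>i\<in>{..n} \<inter> {..degree P}. norm (coeff P i) * r ^ i)"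
      by (intro sum.mono_neutral_right) (auto simp: coeff_eq_0)
    also have "\<dots> \<le> A" unfolding A_def using r by (intro sum_mono2) auto
    finally show ?thesis .
  qed
  obtain n0 :: nat where n0: "A * r\<^sup>2 \<le> real n0" using real_arch_simple by blast
  define M where "M = (\<Sum>k\<le>Suc n0. norm (?c k) * r ^ k)"
  have M0: "M \<ge> 0" unfolding M_def using r by (intro sum_nonneg) auto
  have "norm (?c n) * r ^ n \<le> M" for n
  proof (induction n rule: less_induct)
    case (less n)
    show ?case
    proof (cases "n \<le> Suc n0")
      case True
      then show ?thesis unfolding M_def using r by (intro member_le_sum) auto
    next
      case False
      then obtain k where n: "n = Suc (Suc k)" and k: "k \<ge> n0" by (cases n; cases "n - 1") auto
      have D: "norm (of_nat (Suc k) * of_nat (Suc (Suc k)) :: complex) = real (Suc k) * real (Suc (Suc k))"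
        by (simp only: norm_mult norm_of_nat)
      have "norm (?c n) * r ^ n = norm (\<Sum>i\<le>k. coeff P i * ?c (k - i)) * r ^ n / (real (Suc k) * real (Suc (Suc k)))"
        unfolding n sol_coeff.simps norm_divide D by simp
      also have "norm (\<Sum>i\<le>k. coeff P i * ?c (k - i)) * r ^ n \<le> (\<Sum>i\<le>k. norm (coeff P i) * norm (?c (k - i))) * r ^ n"
        using r by (intro mult_right_mono order_trans[OF norm_sum]) (auto simp: norm_mult)
      also have "\<dots> = r\<^sup>2 * (\<Sum>i\<le>k. (norm (coeff P i) * r ^ i) * (norm (?c (k - i)) * r ^ (k - i)))"
        unfolding sum_distrib_left sum_distrib_right
      proof (intro sum.cong refl)
        fix i assume "i \<in> {..k}"
        then have "r ^ n = r\<^sup>2 * (r ^ i * r ^ (k - i))"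
          by (simp add: n power2_eq_square flip: power_add)
        then show "norm (coeff P i) * norm (?c (k - i)) * r ^ n =
            r\<^sup>2 * (norm (coeff P i) * r ^ i * (norm (?c (k - i)) * r ^ (k - i)))" by simp
      qed
      also have "\<dots> \<le> r\<^sup>2 * (\<Sum>i\<le>k. (norm (coeff P i) * r ^ i) * M)"
        using r n by (intro mult_left_mono sum_mono less.IH) auto
      also have "\<dots> \<le> r\<^sup>2 * (A * M)"
        using M0 A[of k] by (intro mult_left_mono) (auto simp flip: sum_distrib_right intro!: mult_right_mono)
      also have "\<dots> = (A * r\<^sup>2) * M" by simp
      also have "\<dots> \<le> (real (Suc k) * real (Suc (Suc k))) * M"
      proof (intro mult_right_mono M0)
        have "A * r\<^sup>2 \<le> real (Suc k) * 1" using n0 k by simp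
        also have "\<dots> \<le> real (Suc k) * real (Suc (Suc k))" by (intro mult_left_mono) auto
        finally show "A * r\<^sup>2 \<le> real (Suc k) * real (Suc (Suc k))" .
      qed
      finally show ?thesis by (simp add: divide_right_mono del: of_nat_Suc)
    qed
  qed
  then show ?thesis by (rule that)
qed

lemma sol_coeff_abs_summable: "summable (\<lambda>n. norm (sol_coeff P a b n * z ^ n))"
proof -
  \<comment> \<open>The factor 2 yields a geometric majorant of ratio 1/2; the summand 1 keeps
    \<open>r\<close> positive at \<open>z = 0\<close>.\<close>
  define r where "r = 2 * (norm z + 1)"
  have r: "r > 0" by (auto simp: r_def intro: add_nonneg_pos)
  obtain M where M: "\<And>n. norm (sol_coeff P a b n) * r ^ n \<le> M" using sol_coeff_bounded[OF r] by blast
  show ?thesis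
  proof (rule summable_comparison_test'[where N = 0])
    show "summable (\<lambda>n. M * (1 / 2 :: real) ^ n)" by (intro summable_mult summable_geometric) simp
    fix n :: nat
    have "norm z ^ n \<le> (r / 2) ^ n" by (intro power_mono) (auto simp: r_def)
    then have "norm (sol_coeff P a b n) * norm z ^ n \<le> norm (sol_coeff P a b n) * (r / 2) ^ n"
      by (intro mult_left_mono) auto
    also have "\<dots> = norm (sol_coeff P a b n) * r ^ n * (1 / 2) ^ n" by (simp add: power_divide)
    also have "\<dots> \<le> M * (1 / 2) ^ n" by (intro mult_right_mono M) auto
    finally show "norm (norm (sol_coeff P a b n * z ^ n)) \<le> M * (1 / 2) ^ n"
      by (simp add: norm_mult norm_power)
  qed
qed

text \<open>The series is differentiated termwise twice. By the recursion of
  \<open>sol_coeff\<close>, the coefficients of the second derivative are those of the Cauchy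
  product of \<open>P\<close> with the series.\<close>

lemma classical_sol_exists:
  fixes P :: "complex poly"
  obtains w w' where "classical_sol S (\<lambda>x. poly P (of_real x)) w w'" "w 0 = a" "w' 0 = b"
proof -
  let ?c = "sol_coeff P a b"
  define W where "W = (\<lambda>d (z::complex). \<Sum>n. d n * z ^ n :: complex)"
  have s0: "summable (\<lambda>n. ?c n * z ^ n)" for z using sol_coeff_abs_summable by (rule summable_norm_cancel)
  have s1: "summable (\<lambda>n. diffs ?c n * z ^ n)" for z by (rule termdiff_converges_all[OF s0])
  have d0: "(W ?c has_field_derivative W (diffs ?c) z) (at z)" for z
    unfolding W_def by (rule termdiffs_strong_converges_everywhere[OF s0])
  have d1: "(W (diffs ?c) has_field_derivative W (diffs (diffs ?c)) z) (at z)" for z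
    unfolding W_def by (rule termdiffs_strong_converges_everywhere[OF s1])
  have ode: "W (diffs (diffs ?c)) z = poly P z * W ?c z" for z
  proof -
    have fin: "coeff P k * z ^ k = 0" if "k \<notin> {..degree P}" for k using that by (simp add: coeff_eq_0)
    have "summable (\<lambda>k. norm (coeff P k * z ^ k))"
      by (rule summable_finite[of "{..degree P}"]) (use fin in auto)
    from Cauchy_product_sums[OF this sol_coeff_abs_summable[of P a b z]]
    have "(\<lambda>k. \<Sum>i\<le>k. coeff P i * z ^ i * (?c (k - i) * z ^ (k - i))) sums ((\<Sum>k. coeff P k * z ^ k) * W ?c z)"
      by (simp add: W_def)
    also have "(\<Sum>k. coeff P k * z ^ k) = poly P z"
      unfolding poly_altdef by (rule suminf_finite) (use fin in auto)
    also have "(\<lambda>k. \<Sum>i\<le>k. coeff P i * z ^ i * (?c (k - i) * z ^ (k - i))) = (\<lambda>n. diffs (diffs ?c) n * z ^ n)"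
    proof
      fix n
      have "diffs (diffs ?c) n = (\<Sum>i\<le>n. coeff P i * ?c (n - i))"
        unfolding diffs_def sol_coeff.simps by (simp del: of_nat_Suc)
      then show "(\<Sum>i\<le>n. coeff P i * z ^ i * (?c (n - i) * z ^ (n - i))) = diffs (diffs ?c) n * z ^ n"
      proof (simp only: sum_distrib_right, intro sum.cong refl)
        fix i assume "i \<in> {..n}"
        then have "z ^ n = z ^ i * z ^ (n - i)" by (simp flip: power_add)
        then show "coeff P i * z ^ i * (?c (n - i) * z ^ (n - i)) = coeff P i * ?c (n - i) * z ^ n" by simp
      qed
    qed
    finally show ?thesis unfolding W_def by (simp add: sums_iff)
  qed
  show ?thesis
  proof
    show "classical_sol S (\<lambda>x. poly P (of_real x)) (\<lambda>x. W ?c (of_real x)) (\<lambda>x. W (diffs ?c) (of_real x))"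
      unfolding classical_sol_def
      by (auto intro!: has_vector_derivative_real_field d0 has_vector_derivative_eq_rhs[OF has_vector_derivative_real_field[OF d1]] simp: ode)
    show "W ?c (of_real 0) = a" "W (diffs ?c) (of_real 0) = b"
      unfolding W_def by (simp_all add: powser_zero diffs_def)
  qed
qed

lemma fundamental_system_exists:
  fixes P :: "complex poly"
  obtains u u' v v' where
    "classical_sol {0..} (\<lambda>x. poly P (of_real x)) u u'" "classical_sol {0..} (\<lambda>x. poly P (of_real x)) v v'"
    "\<And>x. x \<ge> 0 \<Longrightarrow> u x * v' x - u' x * v x = 1"
proof -
  obtain u u' where u: "classical_sol {0..} (\<lambda>x. poly P (of_real x)) u u'" "u 0 = 1" "u' 0 = 0"
    by (rule classical_sol_exists)
  obtain v v' where v: "classical_sol {0..} (\<lambda>x. poly P (of_real x)) v v'" "v 0 = 0" "v' 0 = 1"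
    by (rule classical_sol_exists)
  obtain C where C: "\<And>x. x \<in> {0..} \<Longrightarrow> u x * v' x - u' x * v x = C"
    using wronskian_constant[OF _ u(1) v(1)] convex_real_interval by blast
  from C[of 0] u v have "C = 1" by simp
  with C show ?thesis by (intro that[OF u(1) v(1)]) auto
qed

lemma classical_sol_initial_value:
  fixes P :: "complex poly"
  assumes "X \<ge> 0"
  obtains w w' where "classical_sol {0..} (\<lambda>x. poly P (of_real x)) w w'" "w X = a" "w' X = b"
proof -
  obtain u u' v v' where u: "classical_sol {0..} (\<lambda>x. poly P (of_real x)) u u'"
    and v: "classical_sol {0..} (\<lambda>x. poly P (of_real x)) v v'" and W: "\<And>x. x \<ge> 0 \<Longrightarrow> u x * v' x - u' x * v x = 1"
    by (rule fundamental_system_exists[of P]) blast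
  \<comment> \<open>Cramer's rule for the coefficients that produce the data \<open>a\<close>,
    \<open>b\<close> at \<open>X\<close>; the determinant is the Wronskian, which is 1.\<close>
  define A B where "A = a * v' X - b * v X" and "B = b * u X - a * u' X"
  have 1: "A * u X + B * v X = a * (u X * v' X - u' X * v X)"
    and 2: "A * u' X + B * v' X = b * (u X * v' X - u' X * v X)"
    unfolding A_def B_def by algebra+
  show ?thesis
    using that[OF classical_sol_linear_combination[OF u v, of A B]] 1 2 W[OF assms] by simp
qed

text \<open>In a fundamental system the coefficients of \<open>w\<close> are its Wronskians with
  \<open>v\<close> and \<open>u\<close>, and these vanish when evaluated at
  \<open>X\<close>.\<close>

lemma classical_sol_unique:
  fixes P :: "complex poly"
  assumes w: "classical_sol {0..} (\<lambda>x. poly P (of_real x)) w w'" and X: "X \<ge> 0" "w X = 0" "w' X = 0" and x: "x \<ge> 0"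
  shows "w x = 0"
proof -
  obtain u u' v v' where u: "classical_sol {0..} (\<lambda>x. poly P (of_real x)) u u'"
    and v: "classical_sol {0..} (\<lambda>x. poly P (of_real x)) v v'" and W: "\<And>x. x \<ge> 0 \<Longrightarrow> u x * v' x - u' x * v x = 1"
    by (rule fundamental_system_exists[of P]) blast
  obtain a b where ab: "\<And>x. x \<in> {0..} \<Longrightarrow> w x = a * u x + b * v x" "\<And>x. x \<in> {0..} \<Longrightarrow> w' x = a * u' x + b * v' x"
    by (rule classical_sol_eq_combination[OF _ u v w, of 1]) (use W in auto)
  have "a * (u X * v' X - u' X * v X) = w X * v' X - w' X * v X" "b * (u X * v' X - u' X * v X) = u X * w' X - u' X * w X"
    using X by (simp_all only: ab atLeast_iff) algebra+
  then have "a = 0" "b = 0" using X W by simp_all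
  then show ?thesis using ab x by simp
qed

text \<open>If the Wronskian of \<open>w\<close> and \<open>w0\<close> were nonzero, these two would
  span all solutions, and \<open>z\<close> would be square integrable by linearity. Hence the
  Wronskian is 0 and the two are proportional.\<close>

lemma L2_classical_sol_unique:
  fixes P :: "complex poly"
  assumes w: "classical_sol {0..} (\<lambda>x. poly P (of_real x)) w w'" and w0: "classical_sol {0..} (\<lambda>x. poly P (of_real x)) w0 w0'"
    and z: "classical_sol {0..} (\<lambda>x. poly P (of_real x)) z z'"
    and L2: "L2_on {0..} w" "L2_on {0..} w0" "\<not> L2_on {0..} z" and nz: "x0 \<ge> 0" "w0 x0 \<noteq> 0"
  obtains a where "\<And>x. x \<ge> 0 \<Longrightarrow> w x = a * w0 x"
proof -
  obtain C where C: "\<And>x. x \<in> {0..} \<Longrightarrow> w x * w0' x - w' x * w0 x = C"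
    using wronskian_constant[OF _ w w0] convex_real_interval by blast
  have "C = 0"
  proof (rule ccontr)
    assume "C \<noteq> 0"
    then obtain a b where "\<And>x. x \<in> {0..} \<Longrightarrow> z x = a * w x + b * w0 x"
      by (metis classical_sol_eq_combination[OF _ w w0 z C] convex_real_interval(1))
    \<comment> \<open>\<open>z\<close> agrees with the combination on \<open>{0..}\<close> only,
      which is all that \<open>L2_on\<close> looks at.\<close>
    then have "L2_on {0..} z \<longleftrightarrow> L2_on {0..} (\<lambda>x. a * w x + b * w0 x)"
      unfolding L2_on_def set_borel_measurable_def set_integrable_def
      by (intro conj_cong arg_cong2[where f = "(\<in>)"] arg_cong2[where f = integrable] ext refl) (auto simp: indicator_def)
    with L2 L2_on_linear_combination show False by blast
  qed
  \<comment> \<open>\<open>w - a * w0\<close> vanishes at \<open>x0\<close> by this choice, and so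
    does its derivative because the Wronskian is 0.\<close>
  define a where "a = w x0 / w0 x0"
  have "classical_sol {0..} (\<lambda>x. poly P (of_real x)) (\<lambda>x. 1 * w x + (- a) * w0 x) (\<lambda>x. 1 * w' x + (- a) * w0' x)"
    by (rule classical_sol_linear_combination[OF w w0])
  from classical_sol_unique[OF this nz(1)] have "1 * w x + (- a) * w0 x = 0" if "x \<ge> 0" for x
    using that C[of x0] \<open>C = 0\<close> nz by (simp add: a_def field_simps)
  then show ?thesis by (intro that[of a]) simp
qed

subsection \<open>The limit-point case\<close>

lemma Re_mult_cnj_self: "Re (z * cnj z) = (norm z)\<^sup>2"
  by (metis complex_norm_square Re_complex_of_real)

lemma has_real_derivative_Re_mult_cnj:
  assumes f: "(f has_vector_derivative f') (at x)" and g: "(g has_vector_derivative g') (at x)"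
  shows "((\<lambda>x. Re (f x * cnj (g x))) has_real_derivative Re (f' * cnj (g x)) + Re (f x * cnj g')) (at x)"
proof -
  have "((\<lambda>x. f x * cnj (g x)) has_vector_derivative f x * cnj g' + f' * cnj (g x)) (at x)"
    by (intro has_vector_derivative_mult f bounded_linear.has_vector_derivative[OF bounded_linear_cnj] g)
  then have "((\<lambda>x. Re (f x * cnj (g x))) has_vector_derivative Re (f x * cnj g' + f' * cnj (g x))) (at x)"
    by (rule bounded_linear.has_vector_derivative[OF bounded_linear_Re])
  then show ?thesis by (simp add: has_real_derivative_iff_has_vector_derivative add.commute)
qed

lemma classical_sol_at:
  assumes "classical_sol {0..} Q w w'" "x > 0"
  shows "(w has_vector_derivative w' x) (at x)" "(w' has_vector_derivative Q x * w x) (at x)"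
proof -
  have "at x within {0..} = at x" using assms(2) by (intro at_within_interior) auto
  with classical_solD[OF assms(1), of x] assms(2)
  show "(w has_vector_derivative w' x) (at x)" "(w' has_vector_derivative Q x * w x) (at x)" by simp_all
qed

text \<open>Product rule, with w'' replaced by Q w. Unrotated, the weight of |w|^2 would be the real
  part of \<open>Q\<close>, which may be negative for all large \<open>x\<close>; the factor \<eta>
  makes it possible for both weights to be nonnegative.\<close>

lemma rotated_energy_derivative:
  assumes w: "classical_sol {0..} Q w w'" and x: "x > 0"
  shows "((\<lambda>x. Re (\<eta> * w' x * cnj (w x))) has_real_derivative
    Re \<eta> * (norm (w' x))\<^sup>2 + Re (\<eta> * Q x) * (norm (w x))\<^sup>2) (at x)"
proof -
  note d = classical_sol_at[OF w x]
  have "((\<lambda>x. \<eta> * w' x) has_vector_derivative \<eta> * (Q x * w x)) (at x)"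
    by (intro has_vector_derivative_mult_right d)
  from has_real_derivative_Re_mult_cnj[OF this d(1)]
  have "((\<lambda>x. Re (\<eta> * w' x * cnj (w x))) has_real_derivative
      Re (\<eta> * (Q x * w x) * cnj (w x)) + Re (\<eta> * w' x * cnj (w' x))) (at x)" .
  also have "\<eta> * (Q x * w x) * cnj (w x) = \<eta> * Q x * of_real ((norm (w x))\<^sup>2)"
    unfolding complex_norm_square by (simp add: mult_ac)
  also have "\<eta> * w' x * cnj (w' x) = \<eta> * of_real ((norm (w' x))\<^sup>2)"
    unfolding complex_norm_square by (simp add: mult_ac)
  also have "Re (\<eta> * Q x * of_real ((norm (w x))\<^sup>2)) + Re (\<eta> * of_real ((norm (w' x))\<^sup>2)) =
      Re \<eta> * (norm (w' x))\<^sup>2 + Re (\<eta> * Q x) * (norm (w x))\<^sup>2"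
    by simp
  finally show ?thesis .
qed

lemma rotated_energy_mono:
  assumes w: "classical_sol {0..} Q w w'" and X: "X > 0" and \<eta>: "Re \<eta> \<ge> 0"
    and Q: "\<And>x. x \<ge> X \<Longrightarrow> Re (\<eta> * Q x) \<ge> 0" and xy: "X \<le> x" "x \<le> y"
  shows "Re (\<eta> * w' x * cnj (w x)) \<le> Re (\<eta> * w' y * cnj (w y))"
proof (rule DERIV_nonneg_imp_nondecreasing[OF xy(2)])
  fix t assume "x \<le> t"
  then have t: "X \<le> t" "t > 0" using X xy by auto
  have "0 \<le> Re \<eta> * (norm (w' t))\<^sup>2 + Re (\<eta> * Q t) * (norm (w t))\<^sup>2"
    using \<eta> Q[OF t(1)] by (intro add_nonneg_nonneg mult_nonneg_nonneg) auto
  with rotated_energy_derivative[OF w t(2)]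
  show "\<exists>y. ((\<lambda>x. Re (\<eta> * w' x * cnj (w x))) has_real_derivative y) (at t) \<and> 0 \<le> y" by blast
qed

text \<open>With \<open>F = Re (\<eta> w' cnj w)\<close> positive, \<open>F' \<ge> Re \<eta> |w'|\<^sup>2 \<ge> Re \<eta> F\<^sup>2 / |w|\<^sup>2\<close>, so \<open>1 / |w|\<^sup>2\<close> is dominated by
  the derivative of the bounded function \<open>- 1 / (Re \<eta> F)\<close>; since \<open>|w|\<^sup>2 + 1 / |w|\<^sup>2 \<ge> 2\<close>, the function \<open>|w|\<^sup>2\<close> cannot
  be integrable as well.\<close>

lemma not_L2_on_if_rotated_energy_pos:
  assumes w: "classical_sol {0..} Q w w'" and X: "X > 0" and \<eta>: "Re \<eta> > 0"
    and Q: "\<And>x. x \<ge> X \<Longrightarrow> Re (\<eta> * Q x) \<ge> 0" and pos: "Re (\<eta> * w' X * cnj (w X)) > 0"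
  shows "\<not> L2_on {0..} w"
proof
  assume L2: "L2_on {0..} w"
  define F where "F = (\<lambda>x. Re (\<eta> * w' x * cnj (w x)))"
  define F' where "F' = (\<lambda>x. Re \<eta> * (norm (w' x))\<^sup>2 + Re (\<eta> * Q x) * (norm (w x))\<^sup>2)"
  \<comment> \<open>The denominator comes from \<open>F x\<close> being at most |\<eta>| |w'| |w|,
    so that \<open>k * (F x)\<^sup>2\<close> is at most Re \<eta> |w'|^2 |w|^2.\<close>
  define k where "k = Re \<eta> / (norm \<eta>)\<^sup>2"
  have "\<eta> \<noteq> 0" using \<eta> by auto
  then have k: "k > 0" using \<eta> by (simp add: k_def)
  have FX: "F x \<ge> F X" if "x \<ge> X" for x
    unfolding F_def using \<eta> by (intro rotated_energy_mono[OF w X _ Q]) (use that in auto)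
  have FX0: "F X > 0" using pos by (simp add: F_def)
  have Fpos: "F x > 0" if "x \<ge> X" for x using FX[OF that] FX0 by simp
  have dG: "((\<lambda>x. - (1 / (k * F x))) has_real_derivative F' x / (k * (F x)\<^sup>2)) (at x)" if "x \<ge> X" for x
  proof -
    have "(F has_real_derivative F' x) (at x)"
      unfolding F_def F'_def using that X by (intro rotated_energy_derivative[OF w]) auto
    then show ?thesis using Fpos[OF that] k
      by (auto intro!: derivative_eq_intros simp: power2_eq_square field_simps)
  qed
  have dom: "2 - (norm (w x))\<^sup>2 \<le> F' x / (k * (F x)\<^sup>2)" if "x \<ge> X" for x
  proof -
    have "F x \<le> norm \<eta> * norm (w' x) * norm (w x)"
      unfolding F_def by (rule order_trans[OF complex_Re_le_cmod]) (simp add: norm_mult)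
    then have "(F x)\<^sup>2 \<le> (norm \<eta> * norm (w' x) * norm (w x))\<^sup>2"
      using Fpos[OF that] by (intro power_mono) auto
    then have Fsq: "(F x)\<^sup>2 \<le> (norm \<eta>)\<^sup>2 * (norm (w' x))\<^sup>2 * (norm (w x))\<^sup>2" by (simp add: power_mult_distrib)
    have wnz: "w x \<noteq> 0" using Fpos[OF that] by (auto simp: F_def)
    define B where "B = (norm (w x))\<^sup>2"
    have B: "B > 0" using wnz by (simp add: B_def)
    have "k * (F x)\<^sup>2 \<le> k * ((norm \<eta>)\<^sup>2 * (norm (w' x))\<^sup>2 * B)" using Fsq k by (auto simp: B_def)
    also have "\<dots> = Re \<eta> * (norm (w' x))\<^sup>2 * B" using \<open>\<eta> \<noteq> 0\<close> by (simp add: k_def)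
    also have "\<dots> \<le> F' x * B"
      unfolding F'_def using Q[OF that] B by (intro mult_right_mono) auto
    finally have "1 / B \<le> F' x / (k * (F x)\<^sup>2)"
      using B k Fpos[OF that] by (simp add: field_simps)
    moreover have "2 - B \<le> 1 / B"
    proof -
      have "0 \<le> (B - 1)\<^sup>2" by simp
      then show ?thesis using B by (simp add: field_simps power2_eq_square)
    qed
    ultimately show ?thesis by (simp add: B_def)
  qed
  have cw: "continuous_on {0..} w" by (rule classical_sol_continuous_on[OF w])
  obtain K where K: "\<And>X Y. 0 \<le> X \<Longrightarrow> integral {X..Y} (\<lambda>x. (norm (w x))\<^sup>2) \<le> K"
    using L2_on_atLeast_imp_integral_bounded[OF cw L2] by blast
  have "2 * (Y - X) \<le> K + 1 / (k * F X)" if Y: "Y \<ge> X" for Y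
  proof -
    have 1: "((\<lambda>x. F' x / (k * (F x)\<^sup>2)) has_integral (- (1 / (k * F Y)) - (- (1 / (k * F X))))) {X..Y}"
      using dG Y by (intro fundamental_theorem_of_calculus)
        (auto simp flip: has_real_derivative_iff_has_vector_derivative intro: has_field_derivative_at_within)
    have 2: "(\<lambda>x. (norm (w x))\<^sup>2) integrable_on {X..Y}"
      using X by (intro integrable_continuous_real continuous_intros continuous_on_subset[OF cw]) auto
    have 3: "((\<lambda>x. 2 - (norm (w x))\<^sup>2) has_integral (Y - X) * 2 - integral {X..Y} (\<lambda>x. (norm (w x))\<^sup>2)) {X..Y}"
      using has_integral_diff[OF has_integral_const_real[of "2::real" X Y] integrable_integral[OF 2]] Y by simp
    have "(Y - X) * 2 - integral {X..Y} (\<lambda>x. (norm (w x))\<^sup>2) \<le> - (1 / (k * F Y)) - (- (1 / (k * F X)))"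
      by (rule has_integral_le[OF 3 1]) (use dom in auto)
    moreover have "1 / (k * F Y) > 0" using k Fpos[OF Y] by simp
    moreover have "integral {X..Y} (\<lambda>x. (norm (w x))\<^sup>2) \<le> K" using X by (intro K) auto
    ultimately show ?thesis by linarith
  qed
  \<comment> \<open>The left side grows linearly in the end point while the right side is fixed;
    this end point is beyond the crossing.\<close>
  from this[of "X + \<bar>K + 1 / (k * F X)\<bar> + 1"] show False
    using abs_ge_self[of "K + 1 / (k * F X)"] abs_ge_zero[of "K + 1 / (k * F X)"] by (simp del: abs_ge_zero)
qed

text \<open>From \<open>X\<close> on, \<open>F\<close> is nondecreasing in \<open>x\<close>, so the
  closed conditions \<open>F p (X + real n) \<le> 0\<close> on the unit sphere become stronger with
  \<open>n\<close>. Each can be met, since some nonzero combination vanishes at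
  \<open>X + real n\<close>, where its \<open>F\<close> is 0. For a common \<open>p\<close>,
  \<open>F p / k\<close> stays below 0 while its derivative dominates |w|^2.\<close>

lemma exists_L2_classical_sol:
  fixes P :: "complex poly"
  assumes X: "X > 0" and \<eta>: "Re \<eta> > 0" and k: "k > 0"
    and Q: "\<And>x. x \<ge> X \<Longrightarrow> Re (\<eta> * poly P (of_real x)) \<ge> k"
  obtains w w' x where "classical_sol {0..} (\<lambda>x. poly P (of_real x)) w w'" "L2_on {0..} w" "x \<ge> 0" "w x \<noteq> 0"
proof -
  let ?Q = "\<lambda>x. poly P (of_real x)"
  obtain u u' v v' where u: "classical_sol {0..} ?Q u u'" and v: "classical_sol {0..} ?Q v v'"
    and W: "\<And>x. x \<ge> 0 \<Longrightarrow> u x * v' x - u' x * v x = 1"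
    by (rule fundamental_system_exists[of P]) blast
  have Q0: "Re (\<eta> * ?Q x) \<ge> 0" if "x \<ge> X" for x using Q[OF that] k by linarith
  define F where "F = (\<lambda>(p :: complex \<times> complex) x.
    Re (\<eta> * (fst p * u' x + snd p * v' x) * cnj (fst p * u x + snd p * v x)))"
  define A where "A = (\<lambda>n::nat. sphere 0 1 \<inter> {p. F p (X + real n) \<le> 0})"
  note sol = classical_sol_linear_combination[OF u v]
  have mono: "F p x \<le> F p y" if "X \<le> x" "x \<le> y" for p x y
    unfolding F_def using \<eta> by (intro rotated_energy_mono[OF sol X _ Q0]) (use that in auto)
  have "\<Inter> (range A) \<noteq> {}"
  proof (rule compact_nest)
    fix n
    have "closed {p. F p (X + real n) \<le> 0}"
      unfolding F_def by (intro closed_Collect_le continuous_intros)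
    then show "compact (A n)" unfolding A_def by (intro compact_Int_closed compact_sphere)
    define x where "x = X + real n"
    \<comment> \<open>The pair \<open>(v x, - u x)\<close> gives a combination vanishing at
      \<open>x\<close>. The value 1 keeps the pair nonzero without an appeal to the
      Wronskian.\<close>
    define a where "a = (if v x = 0 \<and> u x = 0 then 1 else v x)"
    have a: "(a, - u x) \<noteq> 0" "a * u x + (- u x) * v x = 0" by (auto simp: a_def zero_prod_def)
    define r where "r = norm (a, - u x)"
    have r: "r > 0" using a by (simp add: r_def)
    define p where "p = (1 / r) *\<^sub>R (a, - u x)"
    have "norm p = 1" using r unfolding p_def norm_scaleR by (simp add: r_def)
    moreover have "fst p * u x + snd p * v x = (1 / r) *\<^sub>R (a * u x + (- u x) * v x)"
      by (simp add: p_def algebra_simps)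
    then have "F p x \<le> 0" unfolding F_def by (simp only: a) simp
    ultimately have "p \<in> A n" by (simp add: A_def x_def)
    then show "A n \<noteq> {}" by blast
  next
    fix m n :: nat assume "m \<le> n"
    then show "A n \<subseteq> A m" unfolding A_def using mono[of "X + real m" "X + real n"] by (auto intro: order_trans)
  qed
  then obtain p where p: "\<And>n. p \<in> A n" by blast
  define w w' where "w = (\<lambda>x. fst p * u x + snd p * v x)" and "w' = (\<lambda>x. fst p * u' x + snd p * v' x)"
  have w: "classical_sol {0..} ?Q w w'" unfolding w_def w'_def by (rule sol)
  have F: "F p x = Re (\<eta> * w' x * cnj (w x))" for x by (simp add: F_def w_def w'_def)
  have neg: "F p x \<le> 0" if x: "x \<ge> X" for x
  proof -
    obtain n :: nat where "x \<le> real n" using real_arch_simple by blast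
    then have "F p x \<le> F p (X + real n)" using x X by (intro mono) auto
    also have "\<dots> \<le> 0" using p[of n] by (simp add: A_def)
    finally show ?thesis .
  qed
  have "L2_on {0..} w"
  proof (rule L2_on_atLeast_if_derivative_dominates)
    show "continuous_on {0..} w" by (rule classical_sol_continuous_on[OF w])
    show "0 \<le> X" using X by simp
    fix x assume x: "X \<le> x"
    show "((\<lambda>x. Re (\<eta> * w' x * cnj (w x)) / k) has_real_derivative
        (Re \<eta> * (norm (w' x))\<^sup>2 + Re (\<eta> * ?Q x) * (norm (w x))\<^sup>2) / k) (at x)"
      using x X by (intro DERIV_cdivide rotated_energy_derivative[OF w]) auto
    have "k * (norm (w x))\<^sup>2 \<le> Re (\<eta> * ?Q x) * (norm (w x))\<^sup>2" using Q[OF x] by (intro mult_right_mono) auto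
    also have "\<dots> \<le> Re \<eta> * (norm (w' x))\<^sup>2 + Re (\<eta> * ?Q x) * (norm (w x))\<^sup>2" using \<eta> by simp
    finally show "(norm (w x))\<^sup>2 \<le> (Re \<eta> * (norm (w' x))\<^sup>2 + Re (\<eta> * ?Q x) * (norm (w x))\<^sup>2) / k"
      using k by (simp add: field_simps)
    show "Re (\<eta> * w' x * cnj (w x)) / k \<le> 0"
      using neg[OF x] k by (simp add: F divide_nonpos_pos)
  qed
  moreover have "\<exists>x\<ge>0. w x \<noteq> 0"
  proof (rule ccontr)
    assume "\<not> ?thesis"
    then have w0: "w x = 0" if "x \<ge> 0" for x using that by blast
    \<comment> \<open>At the interior point 1 both \<open>w\<close> and \<open>w'\<close> vanish; as
      the Wronskian of \<open>u\<close> and \<open>v\<close> is 1, this forces \<open>p = 0\<close>,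
      which is not on the unit sphere.\<close>
    have "(w has_vector_derivative 0) (at 1)"
      by (rule has_vector_derivative_transform_within_open[of "\<lambda>_. 0" 0 1 "{0<..}"]) (use w0 in auto)
    then have "w' 1 = 0" using classical_sol_at(1)[OF w, of 1] by (simp add: vector_derivative_unique_at)
    with w0[of 1] have "fst p * u 1 + snd p * v 1 = 0" "fst p * u' 1 + snd p * v' 1 = 0"
      by (simp_all add: w_def w'_def)
    moreover have "fst p * (u 1 * v' 1 - u' 1 * v 1) = (fst p * u 1 + snd p * v 1) * v' 1 - (fst p * u' 1 + snd p * v' 1) * v 1"
      "snd p * (u 1 * v' 1 - u' 1 * v 1) = u 1 * (fst p * u' 1 + snd p * v' 1) - u' 1 * (fst p * u 1 + snd p * v 1)"
      by algebra+
    ultimately have "fst p = 0" "snd p = 0" using W[of 1] by auto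
    then have "p = 0" by (simp add: prod_eq_iff)
    with p[of 0] show False by (simp add: A_def)
  qed
  ultimately show ?thesis using that w by blast
qed

subsection \<open>The limit-circle case\<close>

text \<open>The term \<open>p x powr (- p - 1) Re (w' cnj w)\<close> added to the energy \<open>E\<close> cancels the non-integrable
  part \<open>(p / x) (x powr p |w|\<^sup>2 - x powr (- p) |w'|\<^sup>2)\<close> of \<open>E'\<close>, so that Gronwall's argument bounds \<open>E\<close>.\<close>

lemma L2_on_if_oscillating:
  fixes m :: nat and \<beta> :: complex
  assumes w: "classical_sol {0..} (\<lambda>x. \<beta> - of_real x ^ m) w w'" and m: "m \<ge> 3"
  shows "L2_on {0..} w"
proof -
  \<comment> \<open>The Liouville-Green heuristic predicts |w|^2 of order x^(-p) and |w'|^2 of order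
    x^p; \<open>E\<close> is weighted so that both of its summands stay bounded.\<close>
  define p where "p = real m / 2"
  have p: "p > 1" using m by (simp add: p_def)
  define A where "A = (\<lambda>x. Re (w' x * cnj (w' x)))"
  define B where "B = (\<lambda>x. Re (w x * cnj (w x)))"
  define R where "R = (\<lambda>x. Re (w' x * cnj (w x)))"
  define T where "T = (\<lambda>x. Re (\<beta> * w x * cnj (w' x)))"
  define E where "E = (\<lambda>x. A x * x powr (- p) + B x * x powr p)"
  define D where "D = (\<lambda>x. E x + p * (R x * x powr (- p - 1)))"
  \<comment> \<open>What survives the cancellation: two terms caused by \<beta> and one from
    differentiating the weight of \<open>R\<close>.\<close>
  define D' where "D' = (\<lambda>x. 2 * T x * x powr (- p) - p * (p + 1) * R x * x powr (- p - 2) + p * Re \<beta> * B x * x powr (- p - 1))"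
  have A: "A x = (norm (w' x))\<^sup>2" and B: "B x = (norm (w x))\<^sup>2" for x
    unfolding A_def B_def by (rule Re_mult_cnj_self)+
  have D'_deriv: "(D has_real_derivative D' x) (at x)" if x: "x > 0" for x
  proof -
    note d = classical_sol_at[OF w x]
    \<comment> \<open>With all powers written through \<open>s\<close> and \<open>x\<close>, and
      \<open>x ^ m = s * s\<close>, the formula for the derivative becomes a rational
      identity.\<close>
    define s where "s = x powr p"
    have s: "s > 0" using x by (simp add: s_def)
    have pw: "x powr (- p) = 1 / s" "x powr (p - 1) = s / x" "x powr (- p - 1) = 1 / (s * x)"
      "x powr (- p - 2) = 1 / (s * x * x)" "x powr (- p - 1 - 1) = 1 / (s * x * x)"
      using x by (simp_all add: s_def powr_diff powr_minus field_simps power2_eq_square)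
    have xm: "x ^ m = s * s"
      using x by (simp add: s_def p_def powr_realpow[symmetric] flip: powr_add)
    have scale: "Re (complex_of_real r * z) = r * Re z" for r z by simp
    have swap: "Re (a * cnj b) = Re (b * cnj a)" for a b :: complex by (simp add: mult.commute)
    have cross: "Re (w x * cnj (w' x)) = R x" by (simp add: R_def)
    have e1: "Re ((\<beta> - of_real x ^ m) * w x * cnj (w' x)) = T x - x ^ m * R x"
    proof -
      have "(\<beta> - of_real x ^ m) * w x * cnj (w' x) = \<beta> * w x * cnj (w' x) - of_real (x ^ m) * (w x * cnj (w' x))"
        by (simp add: algebra_simps)
      then show ?thesis unfolding T_def by (simp only: minus_complex.sel scale cross)
    qed
    have e2: "Re (w' x * cnj ((\<beta> - of_real x ^ m) * w x)) = T x - x ^ m * R x"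
      using e1 by (simp only: swap[of "w' x"])
    have e3: "Re ((\<beta> - of_real x ^ m) * w x * cnj (w x)) = (Re \<beta> - x ^ m) * B x"
    proof -
      have "(\<beta> - of_real x ^ m) * w x * cnj (w x) = of_real ((norm (w x))\<^sup>2) * (\<beta> - of_real (x ^ m))"
        unfolding complex_norm_square by simp
      then show ?thesis unfolding B by (simp only: scale minus_complex.sel Re_complex_of_real) (rule mult.commute)
    qed
    have dA: "(A has_real_derivative 2 * (T x - x ^ m * R x)) (at x)"
      using has_real_derivative_Re_mult_cnj[OF d(2) d(2)] unfolding e1 e2 A_def by (simp only: mult_2)
    have dB: "(B has_real_derivative 2 * R x) (at x)"
      using has_real_derivative_Re_mult_cnj[OF d(1) d(1)] unfolding cross B_def by (simp only: mult_2 R_def)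
    have dR: "(R has_real_derivative (Re \<beta> - x ^ m) * B x + A x) (at x)"
      using has_real_derivative_Re_mult_cnj[OF d(2) d(1)] unfolding e3 by (simp only: R_def A_def)
    have dp: "((\<lambda>x. x powr r) has_real_derivative r * x powr (r - 1)) (at x)" for r
      using x by (rule has_real_derivative_powr)
    have "(D has_real_derivative
        ((A x * (- p * x powr (- p - 1)) + 2 * (T x - x ^ m * R x) * x powr (- p)) +
         (B x * (p * x powr (p - 1)) + 2 * R x * x powr p)) +
         p * (R x * ((- p - 1) * x powr (- p - 1 - 1)) + ((Re \<beta> - x ^ m) * B x + A x) * x powr (- p - 1))) (at x)"
      unfolding D_def E_def by (intro DERIV_add DERIV_cmult DERIV_mult' dA dB dR dp)
    also have "((A x * (- p * x powr (- p - 1)) + 2 * (T x - x ^ m * R x) * x powr (- p)) +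
         (B x * (p * x powr (p - 1)) + 2 * R x * x powr p)) +
         p * (R x * ((- p - 1) * x powr (- p - 1 - 1)) + ((Re \<beta> - x ^ m) * B x + A x) * x powr (- p - 1)) = D' x"
      unfolding D'_def pw xm s_def[symmetric] using x s by (simp add: field_simps)
    finally show ?thesis .
  qed
  \<comment> \<open>Beyond \<open>X\<close> one has \<open>s \<ge> 1\<close> and
    \<open>p / (s * x) \<le> 1\<close>, so the correction in \<open>D\<close> is at most
    \<open>E x / 2\<close> and \<open>D\<close> controls \<open>E\<close>.\<close>
  define X where "X = max 1 p"
  have X: "X \<ge> 1" "X \<ge> p" by (auto simp: X_def)
  \<comment> \<open>The summands bound the three terms of \<open>D'\<close>, in the order of its
    definition, by multiples of \<open>E x / s\<close>.\<close>
  define C where "C = norm \<beta> + p * (p + 1) + p * norm \<beta>"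
  have C: "C \<ge> 0" using p by (simp add: C_def)
  have basic: "0 \<le> E x" "E x \<le> 2 * D x" "D' x \<le> 2 * C * x powr (- p) * D x" "(norm (w x))\<^sup>2 \<le> x powr (- p) * E x"
    if x: "x \<ge> X" for x
  proof -
    have x1: "x \<ge> 1" "x \<ge> p" "x > 0" using x X by auto
    define s where "s = x powr p"
    have s: "s \<ge> 1" using x1 p by (simp add: s_def ge_one_powr_ge_zero)
    have pw: "x powr (- p) = 1 / s" "x powr (- p - 1) = 1 / (s * x)" "x powr (- p - 2) = 1 / (s * x * x)"
      using x1 by (simp_all add: s_def powr_diff powr_minus field_simps power2_eq_square)
    have Es: "E x = A x / s + s * B x" by (simp add: E_def pw s_def[symmetric])
    have AB: "A x \<ge> 0" "B x \<ge> 0" by (auto simp: A B)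
    show E0: "0 \<le> E x" unfolding Es using AB s by (intro add_nonneg_nonneg) auto
    have BE: "B x \<le> E x / s"
      using AB s by (simp add: Es field_simps)
    show "(norm (w x))\<^sup>2 \<le> x powr (- p) * E x" using BE by (simp add: B pw)
    have ww: "norm (w' x) * norm (w x) \<le> E x / 2"
    proof -
      \<comment> \<open>Arithmetic-geometric mean, with the weight \<open>s\<close> that balances
        the two summands of \<open>E\<close>.\<close>
      have "0 \<le> (norm (w' x) - s * norm (w x))\<^sup>2" by simp
      then have "2 * s * (norm (w' x) * norm (w x)) \<le> A x + s * s * B x"
        by (simp add: A B power2_eq_square algebra_simps)
      also have "\<dots> = s * E x" using s by (simp add: Es field_simps)
      finally show ?thesis using s by simp
    qed
    have Rb: "\<bar>R x\<bar> \<le> E x / 2"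
      unfolding R_def by (rule order_trans[OF abs_Re_le_cmod]) (use ww in \<open>simp add: norm_mult\<close>)
    have Tb: "\<bar>T x\<bar> \<le> norm \<beta> * (E x / 2)"
      unfolding T_def
      by (rule order_trans[OF abs_Re_le_cmod])
        (use mult_left_mono[OF ww norm_ge_zero[of \<beta>]] in \<open>simp add: norm_mult mult_ac\<close>)
    have "\<bar>p * (R x * x powr (- p - 1))\<bar> \<le> E x / 2"
    proof -
      have "p / (s * x) \<le> 1" using s x1 mult_mono[of 1 s p x] p by simp
      then have "p / (s * x) * \<bar>R x\<bar> \<le> 1 * (E x / 2)"
        using Rb E0 by (intro mult_mono) auto
      then show ?thesis using p s x1 by (simp add: pw abs_mult)
    qed
    moreover have "e \<le> 2 * (e + t)" if "\<bar>t\<bar> \<le> e / 2" for e t :: real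
      using abs_le_D2[OF that] by simp
    ultimately show ED: "E x \<le> 2 * D x" unfolding D_def by blast
    have "D' x \<le> C * (E x / s)"
    proof -
      have 1: "2 * T x * x powr (- p) \<le> norm \<beta> * (E x / s)"
        using Tb s by (simp add: pw field_simps)
      have 2: "- (p * (p + 1) * R x * x powr (- p - 2)) \<le> p * (p + 1) * (E x / s)"
      proof -
        have "1 / (x * x) \<le> 1" using x1 mult_mono[of 1 x 1 x] by simp
        then have "- R x * (1 / (x * x)) \<le> \<bar>R x\<bar> * 1" using x1 by (intro mult_mono) auto
        also have "\<dots> \<le> E x" using Rb E0 by simp
        finally have "p * (p + 1) / s * (- R x * (1 / (x * x))) \<le> p * (p + 1) / s * E x"
          using p s by (intro mult_left_mono) auto
        then show ?thesis by (simp add: pw mult_ac)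
      qed
      have 3: "p * Re \<beta> * B x * x powr (- p - 1) \<le> p * norm \<beta> * (E x / s)"
      proof -
        have "1 / (s * x) \<le> 1" using s x1 mult_mono[of 1 s 1 x] by simp
        then have "B x * (1 / (s * x)) \<le> E x / s * 1"
          using BE AB s x1 E0 by (intro mult_mono) auto
        then have "(p * norm \<beta>) * (B x * (1 / (s * x))) \<le> (p * norm \<beta>) * (E x / s * 1)"
          using p by (intro mult_left_mono) auto
        moreover have "(p * Re \<beta>) * (B x * (1 / (s * x))) \<le> (p * norm \<beta>) * (B x * (1 / (s * x)))"
          using p AB s x1 complex_Re_le_cmod[of \<beta>] by (intro mult_right_mono mult_left_mono) auto
        ultimately show ?thesis by (simp add: pw)
      qed
      show ?thesis using 1 2 3 unfolding D'_def C_def distrib_right[of _ _ "E x / s"] by linarith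
    qed
    also have "\<dots> \<le> C * (2 * D x / s)" using ED s C by (intro mult_left_mono divide_right_mono) auto
    finally show "D' x \<le> 2 * C * x powr (- p) * D x" by (simp add: pw mult_ac)
  qed
  \<comment> \<open>Integrating factor for \<open>D' \<le> 2 * C * x powr (- p) * D\<close>: it
    makes \<open>D * exp h\<close> nonincreasing. Since \<open>p > 1\<close>, \<open>h\<close> is
    nonnegative, so \<open>D\<close> itself lies below this product.\<close>
  define h where "h = (\<lambda>x. 2 * C / (p - 1) * x powr (1 - p))"
  have dh: "(h has_real_derivative - (2 * C * x powr (- p))) (at x)" if "x > 0" for x
  proof -
    have "(h has_real_derivative 2 * C / (p - 1) * ((1 - p) * x powr (1 - p - 1))) (at x)"
      unfolding h_def using that by (intro DERIV_cmult has_real_derivative_powr)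
    moreover have "2 * C / (p - 1) * ((1 - p) * x powr (1 - p - 1)) = - (2 * C * x powr (- p))"
      using p by (simp add: field_simps)
    ultimately show ?thesis by simp
  qed
  define H where "H = (\<lambda>x. D x * exp (h x))"
  have D_le: "D x \<le> H X" if x: "x \<ge> X" for x
  proof -
    have D0: "0 \<le> D x" using basic[OF x] by linarith
    have "h x \<ge> 0" using C p by (simp add: h_def)
    then have "D x * 1 \<le> D x * exp (h x)" using D0 by (intro mult_left_mono) auto
    then have "D x \<le> H x" by (simp add: H_def)
    also have "\<dots> \<le> H X"
    proof (rule DERIV_nonpos_imp_nonincreasing[OF x])
      fix t assume t: "X \<le> t"
      then have t0: "t > 0" using X by linarith
      have "(H has_real_derivative D t * (exp (h t) * - (2 * C * t powr (- p))) + D' t * exp (h t)) (at t)"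
        unfolding H_def by (intro DERIV_mult' D'_deriv DERIV_fun_exp dh t0)
      moreover have "D t * (exp (h t) * - (2 * C * t powr (- p))) + D' t * exp (h t) = (D' t - 2 * C * t powr (- p) * D t) * exp (h t)"
        by (simp add: algebra_simps)
      moreover have "\<dots> \<le> 0" using basic(3)[OF t] by (intro mult_nonpos_nonneg) auto
      ultimately show "\<exists>y. (H has_real_derivative y) (at t) \<and> y \<le> 0" by metis
    qed
    finally show ?thesis .
  qed
  show ?thesis
  proof (rule L2_on_atLeast_if_derivative_dominates)
    show "continuous_on {0..} w" by (rule classical_sol_continuous_on[OF w])
    show "0 \<le> X" using X by simp
    fix x assume x: "X \<le> x"
    then have x0: "x > 0" using X by linarith
    have "0 \<le> D X" using basic[of X] by linarith
    then have HX: "H X \<ge> 0" by (simp add: H_def)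
    have "((\<lambda>x. - (2 * H X / (p - 1)) * x powr (1 - p)) has_real_derivative - (2 * H X / (p - 1)) * ((1 - p) * x powr (1 - p - 1))) (at x)"
      using x0 by (intro DERIV_cmult has_real_derivative_powr)
    moreover have "- (2 * H X / (p - 1)) * ((1 - p) * x powr (1 - p - 1)) = 2 * H X * x powr (- p)"
      using p by (simp add: field_simps)
    ultimately show "((\<lambda>x. - (2 * H X / (p - 1)) * x powr (1 - p)) has_real_derivative 2 * H X * x powr (- p)) (at x)" by simp
    have "(norm (w x))\<^sup>2 \<le> x powr (- p) * E x" by (rule basic[OF x])
    also have "\<dots> \<le> x powr (- p) * (2 * H X)" using basic(2)[OF x] D_le[OF x] by (intro mult_left_mono) auto
    finally show "(norm (w x))\<^sup>2 \<le> 2 * H X * x powr (- p)" by (simp add: mult_ac)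
    show "- (2 * H X / (p - 1)) * x powr (1 - p) \<le> 0" using HX p by (intro mult_nonpos_nonneg) auto
  qed
qed

subsection \<open>The alternative on both half-lines\<close>

text \<open>Kept generic in the predicate \<open>Sol\<close>, so that the alternative can be carried
  from classical solutions to \<open>is_solution\<close> and from one half-line to the other. The
  negative case of \<open>crit\<close> is the limit-point case, the positive one the limit-circle
  case.\<close>

definition limit_alternative :: "bool \<Rightarrow> real set \<Rightarrow> ((real \<Rightarrow> complex) \<Rightarrow> bool) \<Rightarrow> bool" where
  "limit_alternative crit S Sol \<longleftrightarrow>
     (\<not> crit \<longrightarrow>
        (\<exists>w0. Sol w0 \<and> L2_on S w0 \<and> (\<exists>x\<in>S. w0 x \<noteq> 0) \<and>
           (\<forall>w. Sol w \<and> L2_on S w \<longrightarrow> (\<exists>a::complex. \<forall>x\<in>S. w x = a * w0 x)))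
        \<and> (\<exists>w. Sol w \<and> \<not> L2_on S w))
   \<and> (crit \<longrightarrow> (\<forall>w. Sol w \<longrightarrow> L2_on S w))"

lemma limit_alternative_classical:
  fixes \<alpha> \<beta> :: complex and m :: nat
  assumes \<alpha>: "norm \<alpha> = 1" and m: "m \<ge> 3"
  shows "limit_alternative (\<alpha> = -1) {0..} (\<lambda>w. \<exists>w'. classical_sol {0..} (\<lambda>x. \<alpha> * of_real x ^ m + \<beta>) w w')"
proof -
  define P where "P = monom \<alpha> m + [:\<beta>:]"
  have P: "(\<lambda>x. \<alpha> * of_real x ^ m + \<beta>) = (\<lambda>x. poly P (of_real x))"
    by (simp add: P_def poly_monom)
  show ?thesis
  proof (cases "\<alpha> = -1")
    case True
    have "L2_on {0..} w" if "classical_sol {0..} (\<lambda>x. \<alpha> * of_real x ^ m + \<beta>) w w'" for w w'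
      using that True m by (intro L2_on_if_oscillating[of \<beta> m w w']) simp_all
    then show ?thesis using True unfolding limit_alternative_def by blast
  next
    case False
    define \<rho> where "\<rho> = 1 + Re \<alpha>"
    \<comment> \<open>This \<eta> points along the bisector of 1 and the conjugate of \<alpha>. As
      |\<alpha>| = 1, \<open>\<eta> * \<alpha> = \<alpha> + 1\<close>, so \<eta> and
      \<open>\<eta> * \<alpha>\<close> have the same real part \<rho>, which vanishes only for
      \<alpha> = -1.\<close>
    define \<eta> where "\<eta> = 1 + cnj \<alpha>"
    have "\<rho> \<noteq> 0"
    proof
      assume "\<rho> = 0"
      then have "Re \<alpha> = -1" by (simp add: \<rho>_def)
      moreover from this \<alpha> have "Im \<alpha> = 0" using cmod_power2[of \<alpha>] by simp
      ultimately show False using False by (simp add: complex_eq_iff)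
    qed
    moreover have "\<rho> \<ge> 0" using abs_Re_le_cmod[of \<alpha>] \<alpha> by (simp add: \<rho>_def)
    ultimately have \<rho>: "\<rho> > 0" by simp
    have \<eta>: "Re \<eta> > 0" using \<rho> by (simp add: \<eta>_def \<rho>_def)
    have \<eta>\<alpha>: "\<eta> * \<alpha> = \<alpha> + 1"
      using complex_norm_square[of \<alpha>] \<alpha> by (simp add: \<eta>_def algebra_simps)
    \<comment> \<open>From here on \<rho> x^m exceeds the \<beta>-term by at least 1, because x
      \<le> x^m for x \<ge> 1.\<close>
    define X where "X = max 1 ((1 + \<bar>Re (\<eta> * \<beta>)\<bar>) / \<rho>)"
    have X: "X \<ge> 1" by (simp add: X_def)
    have Q: "Re (\<eta> * poly P (of_real x)) \<ge> 1" if x: "x \<ge> X" for x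
    proof -
      have scale: "Re (complex_of_real r * z) = r * Re z" for r z by simp
      have x1: "x \<ge> 1" using x X by linarith
      have "(1 + \<bar>Re (\<eta> * \<beta>)\<bar>) / \<rho> \<le> x" using x by (simp add: X_def)
      also have "x \<le> x ^ m" using x1 m power_increasing[of 1 m x] by simp
      finally have "1 + \<bar>Re (\<eta> * \<beta>)\<bar> \<le> \<rho> * x ^ m" using \<rho> by (simp add: field_simps)
      moreover have "\<eta> * poly P (of_real x) = of_real (x ^ m) * (\<alpha> + 1) + \<eta> * \<beta>"
        using \<eta>\<alpha> by (simp add: P_def poly_monom algebra_simps flip: mult.assoc)
      then have "Re (\<eta> * poly P (of_real x)) = x ^ m * \<rho> + Re (\<eta> * \<beta>)"
        by (simp only: plus_complex.sel scale one_complex.sel \<rho>_def add.commute)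
      ultimately show ?thesis
        using abs_ge_minus_self[of "Re (\<eta> * \<beta>)"] by (simp only: mult.commute[of "x ^ m"])
    qed
    obtain w0 w0' x0 where w0: "classical_sol {0..} (\<lambda>x. poly P (of_real x)) w0 w0'" "L2_on {0..} w0" "x0 \<ge> 0" "w0 x0 \<noteq> 0"
      by (rule exists_L2_classical_sol[of X \<eta> 1 P]) (use X \<eta> Q in auto)
    \<comment> \<open>With value and derivative both 1 at \<open>X\<close>, the rotated energy there
      equals Re \<eta>, which is positive.\<close>
    obtain z z' where z: "classical_sol {0..} (\<lambda>x. poly P (of_real x)) z z'" "z X = 1" "z' X = 1"
      by (rule classical_sol_initial_value[of X P 1 1]) (use X in auto)
    have nz: "\<not> L2_on {0..} z"
    proof (rule not_L2_on_if_rotated_energy_pos[OF z(1)])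
      show "X > 0" using X by simp
      show "Re \<eta> > 0" by (rule \<eta>)
      show "Re (\<eta> * poly P (of_real x)) \<ge> 0" if "x \<ge> X" for x using Q[OF that] by linarith
      show "Re (\<eta> * z' X * cnj (z X)) > 0" using z \<eta> by simp
    qed
    have "\<exists>a. \<forall>x\<in>{0..}. w x = a * w0 x"
      if "classical_sol {0..} (\<lambda>x. poly P (of_real x)) w w'" "L2_on {0..} w" for w w'
      using L2_classical_sol_unique[OF that(1) w0(1) z(1) that(2) w0(2) nz w0(3,4)] by (metis atLeast_iff)
    with w0 z nz False show ?thesis
      unfolding P limit_alternative_def by (metis atLeast_iff)
  qed
qed

lemma limit_alternative_reflect:
  assumes "limit_alternative crit S Sol" and Sol: "\<And>w. Sol' w \<longleftrightarrow> Sol (\<lambda>x. w (- x))"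
  shows "limit_alternative crit (uminus ` S) Sol'"
proof -
  have L2: "L2_on (uminus ` S) w \<longleftrightarrow> L2_on S (\<lambda>x. w (- x))" for w
    using L2_on_reflect[of "uminus ` S" w] L2_on_reflect[of S "\<lambda>x. w (- x)"] by (auto simp: image_image)
  show ?thesis
  proof (cases crit)
    case True
    then show ?thesis using assms by (simp add: limit_alternative_def L2)
  next
    case False
    with assms(1) obtain w0 z where w0: "Sol w0" "L2_on S w0" "\<exists>x\<in>S. w0 x \<noteq> 0"
      and un: "\<And>w. Sol w \<Longrightarrow> L2_on S w \<Longrightarrow> \<exists>a. \<forall>x\<in>S. w x = a * w0 x" and z: "Sol z" "\<not> L2_on S z"
      unfolding limit_alternative_def by blast
    have "\<exists>a. \<forall>x\<in>uminus ` S. w x = a * w0 (- x)" if "Sol' w" "L2_on (uminus ` S) w" for w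
      using un[of "\<lambda>x. w (- x)"] that by (auto simp: Sol L2)
    moreover have "Sol' (\<lambda>x. w0 (- x))" "L2_on (uminus ` S) (\<lambda>x. w0 (- x))" "\<exists>x\<in>uminus ` S. w0 (- x) \<noteq> 0"
      "Sol' (\<lambda>x. z (- x))" "\<not> L2_on (uminus ` S) (\<lambda>x. z (- x))"
      using w0 z by (auto simp: Sol L2)
    ultimately show ?thesis using False unfolding limit_alternative_def by blast
  qed
qed

text \<open>Solving for w'' gives \<alpha> = \<open>- \<kappa> / c\<close>, of modulus 1, and
  \<beta> = \<open>- lam / c\<close>. The critical value \<alpha> = -1 means
  \<open>\<kappa> = c\<close>, a condition free of \<open>lam\<close>.\<close>

lemma limit_alternative_atLeast:
  fixes c \<kappa> lam :: complex
  assumes "norm c = 1" "norm \<kappa> = 1" "m \<ge> 3"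
  shows "limit_alternative (\<kappa> = c) {0..} (is_solution {0..} c (\<lambda>x. \<kappa> * of_real x ^ m) lam)"
proof -
  have c: "c \<noteq> 0" using assms by auto
  have Q: "(\<lambda>x. - (\<kappa> * of_real x ^ m + lam) / c) = (\<lambda>x::real. (- \<kappa> / c) * of_real x ^ m + (- lam / c))"
    using c by (auto simp: field_simps)
  have "is_solution {0..} c (\<lambda>x. \<kappa> * of_real x ^ m) lam =
      (\<lambda>w. \<exists>w'. classical_sol {0..} (\<lambda>x. (- \<kappa> / c) * of_real x ^ m + (- lam / c)) w w')"
    using is_solution_iff_classical[OF _ _ c, of "{0..}" "\<lambda>x. \<kappa> * of_real x ^ m" lam] unfolding Q
    by (intro ext) (simp add: is_interval_ci continuous_intros)
  moreover have "- \<kappa> / c = -1 \<longleftrightarrow> \<kappa> = c" using c by (simp add: field_simps)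
  ultimately show ?thesis
    using limit_alternative_classical[of "- \<kappa> / c" m "- lam / c"] assms by (simp add: norm_divide)
qed

text \<open>The coefficient is written as a power of \<open>- x\<close>, so that the reflected
  equation is literally the one on the right half-line.\<close>

lemma limit_alternative_atMost:
  fixes c \<kappa> lam :: complex
  assumes "norm c = 1" "norm \<kappa> = 1" "m \<ge> 3"
  shows "limit_alternative (\<kappa> = c) {..0} (is_solution {..0} c (\<lambda>x. \<kappa> * of_real (- x) ^ m) lam)"
proof -
  have c: "c \<noteq> 0" using assms by auto
  have im: "uminus ` {0..} = {..0::real}" "uminus ` {..0} = {0::real..}" by simp_all
  have "limit_alternative (\<kappa> = c) (uminus ` {0..}) (is_solution {..0} c (\<lambda>x. \<kappa> * of_real (- x) ^ m) lam)"
  proof (rule limit_alternative_reflect[OF limit_alternative_atLeast[OF assms, of lam]])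
    fix w
    have 1: "is_solution {..0} c (\<lambda>x. \<kappa> * of_real (- x) ^ m) lam w \<longleftrightarrow>
        (\<exists>w'. classical_sol {..0} (\<lambda>x. - (\<kappa> * of_real (- x) ^ m + lam) / c) w w')"
      by (intro is_solution_iff_classical c is_interval_ic closed_atMost continuous_intros)
    have 2: "is_solution {0..} c (\<lambda>x. \<kappa> * of_real x ^ m) lam (\<lambda>x. w (- x)) \<longleftrightarrow>
        (\<exists>w'. classical_sol {0..} (\<lambda>x. - (\<kappa> * of_real x ^ m + lam) / c) (\<lambda>x. w (- x)) w')"
      by (intro is_solution_iff_classical c is_interval_ci closed_atLeast continuous_intros)
    show "is_solution {..0} c (\<lambda>x. \<kappa> * of_real (- x) ^ m) lam w \<longleftrightarrow>
        is_solution {0..} c (\<lambda>x. \<kappa> * of_real x ^ m) lam (\<lambda>x. w (- x))"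
    proof
      assume "is_solution {..0} c (\<lambda>x. \<kappa> * of_real (- x) ^ m) lam w"
      with 1 obtain w' where "classical_sol {..0} (\<lambda>x. - (\<kappa> * of_real (- x) ^ m + lam) / c) w w'" by blast
      from classical_sol_reflect[OF this] show "is_solution {0..} c (\<lambda>x. \<kappa> * of_real x ^ m) lam (\<lambda>x. w (- x))"
        unfolding 2 im by auto
    next
      assume "is_solution {0..} c (\<lambda>x. \<kappa> * of_real x ^ m) lam (\<lambda>x. w (- x))"
      with 2 obtain w' where "classical_sol {0..} (\<lambda>x. - (\<kappa> * of_real x ^ m + lam) / c) (\<lambda>x. w (- x)) w'" by blast
      from classical_sol_reflect[OF this] show "is_solution {..0} c (\<lambda>x. \<kappa> * of_real (- x) ^ m) lam w"
        unfolding 1 im by auto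
    qed
  qed
  then show ?thesis by (simp only: im)
qed

text \<open>Writing \<i> as exp(\<i> pi / 2), the equation compares two exponentials of imaginary
  numbers: (N+2)(pi/2 + \<phi>) and -2\<phi> differ by 2 k pi, that is, (N+4) \<phi> = -(N+2) pi/2 +
  2 k pi.\<close>

lemma critical_angle_iff:
  fixes N :: nat and \<phi> :: real
  shows "\<i> ^ (N + 2) * exp (complex_of_nat (N + 2) * \<i> * complex_of_real \<phi>) = exp (- 2 * \<i> * complex_of_real \<phi>) \<longleftrightarrow>
    (\<exists>k::int. \<phi> = - (real N + 2) / (2 * real N + 8) * pi + 2 * real_of_int k / (real N + 4) * pi)"
proof -
  have "\<i> = exp (\<i> * of_real (pi / 2))" using cis_conv_exp[of "pi / 2"] by simp
  then have "\<i> ^ (N + 2) = exp (of_nat (N + 2) * (\<i> * of_real (pi / 2)))"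
    by (metis exp_of_nat_mult)
  then have "\<i> ^ (N + 2) * exp (complex_of_nat (N + 2) * \<i> * complex_of_real \<phi>) =
      exp (of_nat (N + 2) * (\<i> * of_real (pi / 2)) + of_nat (N + 2) * \<i> * of_real \<phi>)"
    by (simp add: exp_add)
  also have "\<dots> = exp (- 2 * \<i> * of_real \<phi>) \<longleftrightarrow> (\<exists>k::int. of_nat (N + 2) * (\<i> * of_real (pi / 2)) + of_nat (N + 2) * \<i> * of_real \<phi> =
      - 2 * \<i> * of_real \<phi> + (of_int (2 * k) * pi) * \<i>)"
    by (rule exp_eq)
  also have "\<dots> \<longleftrightarrow> (\<exists>k::int. \<phi> = - (real N + 2) / (2 * real N + 8) * pi + 2 * real_of_int k / (real N + 4) * pi)"
  proof (rule arg_cong[where f = Ex], rule ext)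
    fix k :: int
    have "of_nat (N + 2) * (\<i> * of_real (pi / 2)) + of_nat (N + 2) * \<i> * of_real \<phi> =
        - 2 * \<i> * of_real \<phi> + (of_int (2 * k) * pi) * \<i> \<longleftrightarrow>
      (real N + 2) * (pi / 2) + (real N + 2) * \<phi> = - 2 * \<phi> + 2 * real_of_int k * pi"
      by (simp add: complex_eq_iff algebra_simps add_divide_distrib)
    also have "\<dots> \<longleftrightarrow> (real N + 4) * \<phi> = - (real N + 2) * pi / 2 + 2 * real_of_int k * pi"
      by (auto simp: algebra_simps add_divide_distrib diff_divide_distrib)
    also have "\<dots> \<longleftrightarrow> \<phi> = (- (real N + 2) * pi / 2 + 2 * real_of_int k * pi) / (real N + 4)"
      by (auto simp: field_simps)
    also have "(- (real N + 2) * pi / 2 + 2 * real_of_int k * pi) / (real N + 4) =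
        - (real N + 2) / (2 * real N + 8) * pi + 2 * real_of_int k / (real N + 4) * pi"
    proof -
      have "(- a * pi / 2 + b * pi) / M = - a / (2 * M) * pi + b / M * pi" if "M \<noteq> 0" for a b M :: real
        using that by (simp add: field_simps)
      from this[of "real N + 4" "real N + 2" "2 * real_of_int k"] show ?thesis by (simp add: algebra_simps)
    qed
    finally show "(of_nat (N + 2) * (\<i> * of_real (pi / 2)) + of_nat (N + 2) * \<i> * of_real \<phi> =
        - 2 * \<i> * of_real \<phi> + (of_int (2 * k) * pi) * \<i>) = (\<phi> = - (real N + 2) / (2 * real N + 8) * pi + 2 * real_of_int k / (real N + 4) * pi)" .
  qed
  finally show ?thesis .
qed

theorem theorem1:
  fixes N :: nat and \<phi> :: real and lam :: complex
  assumes "N \<ge> 1" and "- (pi / 2) < \<phi>" and "\<phi> < pi / 2"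
  defines "crit \<equiv> (\<exists>k::int. \<phi> = - (real N + 2) / (2 * real N + 8) * pi + 2 * real_of_int k / (real N + 4) * pi)"
  shows "\<forall>(S, c, q) \<in>
           { ({0..}, exp (- 2 * \<i> * complex_of_real \<phi>),
              \<lambda>x. (\<i> * complex_of_real x) ^ (N + 2) * exp (complex_of_nat (N + 2) * \<i> * complex_of_real \<phi>)),
             ({..0}, exp (2 * \<i> * complex_of_real \<phi>),
              \<lambda>x. (\<i> * complex_of_real x) ^ (N + 2) * exp (- complex_of_nat (N + 2) * \<i> * complex_of_real \<phi>)) }.
           (\<not> crit \<longrightarrow>
              (\<exists>w0. is_solution S c q lam w0 \<and> L2_on S w0 \<and> (\<exists>x\<in>S. w0 x \<noteq> 0) \<and>
                 (\<forall>w. is_solution S c q lam w \<and> L2_on S w \<longrightarrow> (\<exists>a::complex. \<forall>x\<in>S. w x = a * w0 x)))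
              \<and> (\<exists>w. is_solution S c q lam w \<and> \<not> L2_on S w))
         \<and> (crit \<longrightarrow> (\<forall>w. is_solution S c q lam w \<longrightarrow> L2_on S w))"
proof -
  define c \<kappa> where "c = exp (- 2 * \<i> * complex_of_real \<phi>)"
    and "\<kappa> = \<i> ^ (N + 2) * exp (complex_of_nat (N + 2) * \<i> * complex_of_real \<phi>)"
  have crit: "crit \<longleftrightarrow> \<kappa> = c"
    unfolding crit_def c_def \<kappa>_def by (rule critical_angle_iff[symmetric])
  have n: "norm c = 1" "norm \<kappa> = 1"
    by (simp_all add: c_def \<kappa>_def norm_mult norm_power norm_exp_eq_Re)
  \<comment> \<open>Since \<i> x = (-\<i>)(-x), the equation on the left half-line, in the variable
    -x, has the conjugates of \<open>c\<close> and \<kappa> as coefficients. Conjugation is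
    injective, so both half-lines share the condition \<open>\<kappa> = c\<close> and with it the
    exceptional angles.\<close>
  have cnj: "cnj c = exp (2 * \<i> * complex_of_real \<phi>)"
    "cnj \<kappa> = (- \<i>) ^ (N + 2) * exp (- complex_of_nat (N + 2) * \<i> * complex_of_real \<phi>)"
    by (simp_all add: c_def \<kappa>_def exp_cnj algebra_simps)
  have q1: "(\<lambda>x. (\<i> * complex_of_real x) ^ (N + 2) * exp (complex_of_nat (N + 2) * \<i> * complex_of_real \<phi>)) =
      (\<lambda>x. \<kappa> * of_real x ^ (N + 2))"
    unfolding \<kappa>_def power_mult_distrib by (simp only: mult_ac)
  have q2: "(\<lambda>x. (\<i> * complex_of_real x) ^ (N + 2) * exp (- complex_of_nat (N + 2) * \<i> * complex_of_real \<phi>)) =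
      (\<lambda>x. cnj \<kappa> * of_real (- x) ^ (N + 2))"
  proof
    fix x :: real
    have "(\<i> * complex_of_real x) ^ (N + 2) = ((- \<i>) * of_real (- x)) ^ (N + 2)" by simp
    also have "\<dots> = (- \<i>) ^ (N + 2) * of_real (- x) ^ (N + 2)" by (rule power_mult_distrib)
    finally show "(\<i> * complex_of_real x) ^ (N + 2) * exp (- complex_of_nat (N + 2) * \<i> * complex_of_real \<phi>) =
        cnj \<kappa> * of_real (- x) ^ (N + 2)" unfolding cnj by (simp only: mult_ac)
  qed
  have "limit_alternative crit {0..} (is_solution {0..} c (\<lambda>x. \<kappa> * of_real x ^ (N + 2)) lam)"
    unfolding crit using n assms(1) by (intro limit_alternative_atLeast) auto
  moreover have "limit_alternative (cnj \<kappa> = cnj c) {..0} (is_solution {..0} (cnj c) (\<lambda>x. cnj \<kappa> * of_real (- x) ^ (N + 2)) lam)"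
    using n assms(1) by (intro limit_alternative_atMost) auto
  then have "limit_alternative crit {..0} (is_solution {..0} (cnj c) (\<lambda>x. cnj \<kappa> * of_real (- x) ^ (N + 2)) lam)"
    by (simp add: crit)
  ultimately show ?thesis
    unfolding limit_alternative_def q1 q2 c_def[symmetric] cnj(1)[symmetric] by simp
qed

end
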